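(* Let $w\in\mathbb{C}$ with $\mathrm{Re}(w)=1/2$, and put $\lambda_w=w(w-1)$. (1) If there is a solution $u\in H^1_\eta$ of $(T^\#_\eta-\lambda_w)u=\theta_\eta$, then $\theta_\eta(w)=0$. (2) If $\theta_\eta(w)=0$, then the solution $u$ of $(T^\#_\eta-\lambda_w)u=\theta_\eta$ lies in $H^1_\eta$ and equals $u_w$, where $u_w(s)=\frac{1+\eta c_s}{\lambda_s-\lambda_w}$ for $s\in1/2+i\mathbb{R}$ and $u_w(\tau_i)=\frac{\sqrt{\eta R_i}}{\lambda_{\sigma_i}-\lambda_w}$.
   Context: Let $h(s)$ be a meromorphic function with no zeros in $\mathrm{Re}(s)>1/2$ except for finitely many zeros $\sigma_1,\dots,\sigma_n\in(1/2,\infty)$ (largest $\sigma_n$), real-valued on $\mathbb{R}$, with $c_s:=h(1-s)/h(s)\ll|s|^{1-\epsilon}$ uniformly away from poles in $\mathrm{Re}(s)\ge 1/2$ for some $\epsilon>0$. Fix $\eta\in\{1,-1\}$, let $R_i=\mathrm{Res}_{s=\sigma_i}c_s$, and assume $\eta R_i\ge0$ for all $i$ and that $1+\eta c_s$ is not square-integrable on $1/2+i\mathbb{R}$. Let $S=\{\tau_1,\dots,\tau_n\}$ be abstract points in bijection with the $\sigma_i$; functions live on $(1/2+i\mathbb{R})\sqcup S$. Put $\lambda_s=s(s-1)$ on $1/2+i\mathbb{R}$, $\lambda_{\tau_i}=\lambda_{\sigma_i}=\sigma_i(\sigma_i-1)$, $\int_{(1/2)}g\,ds=\int_{1/2-i\infty}^{1/2+i\infty}g(s)\,ds$,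 and fix a real constant $c>0$ depending on the $\sigma_i$. For $k\in\mathbb{R}$, $H^k_\eta$ is the space of measurable $f$ on $(1/2+i\mathbb{R})\sqcup S$ with $(c-\lambda_s)^kf\in L^2(1/2+i\mathbb{R})\oplus L^2(S)$ and $f(1-s)=\eta f(s)/c_s$ for $\mathrm{Re}(s)=1/2$, with norm $\|f\|^2_{H^k_\eta}=\langle(c-\lambda_s)^kf,f\rangle_{L^2(1/2+i\mathbb{R})}+\langle(c-\lambda_{\sigma_i})^kf,f\rangle_{L^2(S)}$; in particular $\langle v,w\rangle_{H^1_\eta}=\frac{1}{4\pi i}\int_{(1/2)}(c-\lambda_s)v\overline{w}\,ds+\sum_i(c-\lambda_{\sigma_i})v(\tau_i)\overline{w(\tau_i)}$. $H^{-1}_\eta$ is the dual of $H^1_\eta$. $T^\#_\eta:H^1_\eta\to H^{-1}_\eta$ is defined by $((c-T^\#_\eta)v)(w)=\langle v,\overline w\rangle_{H^1_\eta}$; it acts as multiplication by $\lambda_s$ (resp. $\lambda_{\sigma_i}$ at $\tau_i$). Define $\theta_\eta(s)=1+\eta c_s$ for $s\in\mathbb{C}\setminus\{\sigma_1,\dots,\sigma_n\}$ and $\theta_\eta(\tau_i)=\sqrt{\eta R_i}$.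
   Formalization: In (2), for w = 1/2 it is also assumed that θ_η'(1/2) = 0, since for a simple zero there u_w is not in H^1_η; and H^k_η is read through its norm, i.e. (c−λ_s)^{k/2} f (not (c−λ_s)^k f) is in L². *)

theory Defs
  imports "HOL-Complex_Analysis.Complex_Analysis"
begin

text \<open>
  \<^term>\<open>h\<close> is taken to be nicely meromorphic, so it has value 0 at its poles.  The quotient
  below is a meromorphic function: points where \<^term>\<open>h\<close> has a zero or a pole may be removable
  singularities of it, in particular on the line \<open>Re s = 1/2\<close>, and are filled in.
\<close>

definition c_fun :: "(complex \<Rightarrow> complex) \<Rightarrow> complex \<Rightarrow> complex" where
  "c_fun h = remove_sings (\<lambda>s. h (1 - s) / h s)"

definition zeros_right :: "(complex \<Rightarrow> complex) \<Rightarrow> complex set" where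
  "zeros_right h = {s. Re s > 1/2 \<and> h s = 0 \<and> \<not> is_pole h s}"

definition c_growth :: "(complex \<Rightarrow> complex) \<Rightarrow> real \<Rightarrow> bool" where
  "c_growth h \<epsilon> \<longleftrightarrow>
     (\<forall>\<delta>>0. \<exists>C. \<forall>s. Re s \<ge> 1/2 \<and> (\<forall>p. is_pole (c_fun h) p \<longrightarrow> \<delta> \<le> dist s p) \<longrightarrow>
        cmod (c_fun h s) \<le> C * cmod s powr (1 - \<epsilon>))"

definition Res_c :: "(complex \<Rightarrow> complex) \<Rightarrow> (nat \<Rightarrow> real) \<Rightarrow> nat \<Rightarrow> complex" where
  "Res_c h \<sigma> i = residue (c_fun h) (of_real (\<sigma> i))"

definition lam :: "complex \<Rightarrow> complex" where
  "lam s = s * (s - 1)"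

definition crit :: "real \<Rightarrow> complex" where
  "crit t = Complex (1/2) t"

text \<open>Along \<open>s = 1/2 + i t\<close> one has \<open>ds = i dt\<close>.\<close>

definition crit_integral :: "(complex \<Rightarrow> complex) \<Rightarrow> complex" where
  "crit_integral g = \<i> * (\<integral>t. g (crit t) \<partial>lborel)"

definition L2_crit :: "(complex \<Rightarrow> complex) \<Rightarrow> bool" where
  "L2_crit g \<longleftrightarrow> (\<lambda>t. g (crit t)) \<in> borel_measurable lborel \<and>
                  integrable lborel (\<lambda>t. (cmod (g (crit t)))\<^sup>2)"

text \<open>
  Functions on the disjoint union of the line \<open>Re s = 1/2\<close> and \<open>S = {\<tau>\<^sub>1, \<dots>, \<tau>\<^sub>n}\<close> are functions
  on the following type, where \<^term>\<open>Inr i\<close> stands for \<open>\<tau>\<^sub>i\<close>.  Only the values at \<^term>\<open>Inl s\<close> with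
  \<open>Re s = 1/2\<close> and at \<^term>\<open>Inr i\<close> with \<open>1 \<le> i \<le> n\<close> matter; the values of \<open>\<theta>\<close> at other
  complex numbers are allowed for as well.
\<close>

type_synonym point = "complex + nat"

definition lam_at :: "(nat \<Rightarrow> real) \<Rightarrow> point \<Rightarrow> complex" where
  "lam_at \<sigma> = case_sum lam (\<lambda>i. lam (of_real (\<sigma> i)))"

definition inner_L2 :: "nat \<Rightarrow> (point \<Rightarrow> complex) \<Rightarrow> (point \<Rightarrow> complex) \<Rightarrow> complex" where
  "inner_L2 n v w = 1 / (4 * of_real pi * \<i>) * crit_integral (\<lambda>s. v (Inl s) * cnj (w (Inl s)))
                    + (\<Sum>i = 1..n. v (Inr i) * cnj (w (Inr i)))"

definition weight :: "(nat \<Rightarrow> real) \<Rightarrow> real \<Rightarrow> real \<Rightarrow> (point \<Rightarrow> complex) \<Rightarrow> point \<Rightarrow> complex" where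
  "weight \<sigma> c k f x = (of_real c - lam_at \<sigma> x) powr of_real k * f x"

definition inner_H ::
  "nat \<Rightarrow> (nat \<Rightarrow> real) \<Rightarrow> real \<Rightarrow> real \<Rightarrow> (point \<Rightarrow> complex) \<Rightarrow> (point \<Rightarrow> complex) \<Rightarrow> complex" where
  "inner_H n \<sigma> c k v w = inner_L2 n (weight \<sigma> c k v) w"

definition norm_H :: "nat \<Rightarrow> (nat \<Rightarrow> real) \<Rightarrow> real \<Rightarrow> real \<Rightarrow> (point \<Rightarrow> complex) \<Rightarrow> real" where
  "norm_H n \<sigma> c k f = sqrt (Re (inner_H n \<sigma> c k f f))"

text \<open>
  The squared norm \<open>\<langle>(c - \<lambda>)\<^sup>k f, f\<rangle>\<close> is finite iff \<open>(c - \<lambda>)\<^bsup>k/2\<^esup> f\<close> is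
  square-integrable; on the finite set \<open>S\<close> this is no condition.  Elements are representatives,
  to be identified by \<open>eq_H\<close> below.
\<close>

definition H_space ::
  "(complex \<Rightarrow> complex) \<Rightarrow> (nat \<Rightarrow> real) \<Rightarrow> real \<Rightarrow> real \<Rightarrow> real \<Rightarrow> (point \<Rightarrow> complex) set" where
  "H_space h \<sigma> \<eta> c k =
     {f. (\<lambda>t. f (Inl (crit t))) \<in> borel_measurable lborel \<and>
         L2_crit (\<lambda>s. weight \<sigma> c (k / 2) f (Inl s)) \<and>
         (AE t in lborel. f (Inl (1 - crit t)) = of_real \<eta> * f (Inl (crit t)) / c_fun h (crit t))}"

definition eq_H :: "nat \<Rightarrow> (point \<Rightarrow> complex) \<Rightarrow> (point \<Rightarrow> complex) \<Rightarrow> bool" where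
  "eq_H n u v \<longleftrightarrow> (AE t in lborel. u (Inl (crit t)) = v (Inl (crit t))) \<and>
                  (\<forall>i\<in>{1..n}. u (Inr i) = v (Inr i))"

definition H_dual ::
  "(complex \<Rightarrow> complex) \<Rightarrow> nat \<Rightarrow> (nat \<Rightarrow> real) \<Rightarrow> real \<Rightarrow> real \<Rightarrow> ((point \<Rightarrow> complex) \<Rightarrow> complex) set" where
  "H_dual h n \<sigma> \<eta> c =
     {F \<in> extensional (H_space h \<sigma> \<eta> c 1).
        (\<forall>f\<in>H_space h \<sigma> \<eta> c 1. \<forall>g\<in>H_space h \<sigma> \<eta> c 1. F (\<lambda>x. f x + g x) = F f + F g) \<and>
        (\<forall>a. \<forall>f\<in>H_space h \<sigma> \<eta> c 1. F (\<lambda>x. a * f x) = a * F f) \<and>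
        (\<exists>K. \<forall>f\<in>H_space h \<sigma> \<eta> c 1. cmod (F f) \<le> K * norm_H n \<sigma> c 1 f)}"

text \<open>
  A function \<open>g\<close> acts on \<open>H\<^sup>1\<close> by \<open>f \<mapsto> \<langle>g, cnj f\<rangle>\<close> in \<open>L\<^sup>2\<close>; this is the inclusion of
  \<open>H\<^sup>1\<close> (and of \<open>\<theta>\<close>) in the dual under which \<open>T\<^sup>#\<close> is multiplication by \<open>\<lambda>\<close>.
\<close>

definition to_dual ::
  "(complex \<Rightarrow> complex) \<Rightarrow> nat \<Rightarrow> (nat \<Rightarrow> real) \<Rightarrow> real \<Rightarrow> real \<Rightarrow> (point \<Rightarrow> complex) \<Rightarrow>
     (point \<Rightarrow> complex) \<Rightarrow> complex" where
  "to_dual h n \<sigma> \<eta> c g = (\<lambda>f\<in>H_space h \<sigma> \<eta> c 1. inner_L2 n g (\<lambda>x. cnj (f x)))"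

text \<open>Solved for \<open>T\<^sup># v\<close> from \<open>((c - T\<^sup>#) v)(f) = \<langle>v, cnj f\<rangle>\<close> in \<open>H\<^sup>1\<close>.\<close>

definition T_sharp ::
  "(complex \<Rightarrow> complex) \<Rightarrow> nat \<Rightarrow> (nat \<Rightarrow> real) \<Rightarrow> real \<Rightarrow> real \<Rightarrow> (point \<Rightarrow> complex) \<Rightarrow>
     (point \<Rightarrow> complex) \<Rightarrow> complex" where
  "T_sharp h n \<sigma> \<eta> c v =
     (\<lambda>f\<in>H_space h \<sigma> \<eta> c 1.
        of_real c * to_dual h n \<sigma> \<eta> c v f - inner_H n \<sigma> c 1 v (\<lambda>x. cnj (f x)))"

definition theta :: "(complex \<Rightarrow> complex) \<Rightarrow> (nat \<Rightarrow> real) \<Rightarrow> real \<Rightarrow> point \<Rightarrow> complex" where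
  "theta h \<sigma> \<eta> = case_sum (\<lambda>s. 1 + of_real \<eta> * c_fun h s)
                          (\<lambda>i. csqrt (of_real \<eta> * Res_c h \<sigma> i))"

definition u_sol :: "(complex \<Rightarrow> complex) \<Rightarrow> (nat \<Rightarrow> real) \<Rightarrow> real \<Rightarrow> complex \<Rightarrow> point \<Rightarrow> complex" where
  "u_sol h \<sigma> \<eta> w =
     case_sum (\<lambda>s. (1 + of_real \<eta> * c_fun h s) / (lam s - lam w))
              (\<lambda>i. csqrt (of_real \<eta> * Res_c h \<sigma> i) / (lam (of_real (\<sigma> i)) - lam w))"

text \<open>The equation \<open>(T\<^sup># - \<lambda>\<^sub>w) u = \<theta>\<close> in the dual of \<open>H\<^sup>1\<close>.\<close>

definition solves ::
  "(complex \<Rightarrow> complex) \<Rightarrow> nat \<Rightarrow> (nat \<Rightarrow> real) \<Rightarrow> real \<Rightarrow> real \<Rightarrow> complex \<Rightarrow> (point \<Rightarrow> complex) \<Rightarrow> bool" where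
  "solves h n \<sigma> \<eta> c w u \<longleftrightarrow>
     (\<lambda>f\<in>H_space h \<sigma> \<eta> c 1. T_sharp h n \<sigma> \<eta> c u f - lam w * to_dual h n \<sigma> \<eta> c u f)
       = to_dual h n \<sigma> \<eta> c (theta h \<sigma> \<eta>)"

lemma c_minus_lam_crit: "of_real c - lam (crit t) = of_real (c + 1/4 + t\<^sup>2)"
  by (simp add: lam_def crit_def complex_eq_iff power2_eq_square)

lemma H1_line:
  assumes "f \<in> H_space h \<sigma> \<eta> c 1" and "c > 0"
  shows "(\<lambda>t. f (Inl (crit t))) \<in> borel_measurable lborel"
    and "integrable lborel (\<lambda>t. (c + 1/4 + t\<^sup>2) * (cmod (f (Inl (crit t))))\<^sup>2)"
proof -
  show "(\<lambda>t. f (Inl (crit t))) \<in> borel_measurable lborel"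
    using assms(1) by (simp add: H_space_def)
  have "(cmod (weight \<sigma> c (1/2) f (Inl (crit t))))\<^sup>2
          = (c + 1/4 + t\<^sup>2) * (cmod (f (Inl (crit t))))\<^sup>2" for t
  proof -
    have p: "c + 1/4 + t\<^sup>2 > 0"
      using assms(2) zero_le_power2[of t] by linarith
    have "cmod (of_real (c + 1/4 + t\<^sup>2) powr of_real (1/2)) = (c + 1/4 + t\<^sup>2) powr (1/2)"
      using p by (subst norm_powr_real_powr) (auto simp del: of_real_add of_real_power)
    moreover have "((c + 1/4 + t\<^sup>2) powr (1/2))\<^sup>2 = c + 1/4 + t\<^sup>2"
      using p by (simp add: powr_half_sqrt)
    ultimately show ?thesis
      by (simp add: weight_def lam_at_def c_minus_lam_crit norm_mult power_mult_distrib
           del: of_real_add of_real_power)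
  qed
  then show "integrable lborel (\<lambda>t. (c + 1/4 + t\<^sup>2) * (cmod (f (Inl (crit t))))\<^sup>2)"
    using assms(1) by (simp add: H_space_def L2_crit_def)
qed

lemma H1_integrable:
  assumes v: "v \<in> H_space h \<sigma> \<eta> c 1" and f: "f \<in> H_space h \<sigma> \<eta> c 1" and c: "c > 0"
    and m: "continuous_on UNIV m" and mK: "\<And>t. \<bar>m t\<bar> \<le> c + 1/4 + t\<^sup>2"
  shows "integrable lborel (\<lambda>t. of_real (m t) * v (Inl (crit t)) * f (Inl (crit t)))"
    and "cmod (\<integral>t. of_real (m t) * v (Inl (crit t)) * f (Inl (crit t)) \<partial>lborel)
           \<le> (\<integral>t. (c + 1/4 + t\<^sup>2) * (cmod (v (Inl (crit t))))\<^sup>2 \<partial>lborel)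
             + (\<integral>t. (c + 1/4 + t\<^sup>2) * (cmod (f (Inl (crit t))))\<^sup>2 \<partial>lborel)"
proof -
  let ?W = "\<lambda>t::real. c + 1/4 + t\<^sup>2"
  let ?v = "\<lambda>t. v (Inl (crit t))" and ?f = "\<lambda>t. f (Inl (crit t))"
  have [measurable]: "?v \<in> borel_measurable borel" "?f \<in> borel_measurable borel"
    using H1_line(1)[OF v c] H1_line(1)[OF f c] by simp_all
  have [measurable]: "m \<in> borel_measurable borel"
    using m by (rule borel_measurable_continuous_onI)
  have I: "integrable lborel (\<lambda>t. ?W t * (cmod (?v t))\<^sup>2)" "integrable lborel (\<lambda>t. ?W t * (cmod (?f t))\<^sup>2)"
    using H1_line(2)[OF v c] H1_line(2)[OF f c] by simp_all
  have S: "integrable lborel (\<lambda>t. ?W t * (cmod (?v t))\<^sup>2 + ?W t * (cmod (?f t))\<^sup>2)"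
    by (rule Bochner_Integration.integrable_add[OF I])
  have B: "cmod (of_real (m t) * ?v t * ?f t) \<le> ?W t * (cmod (?v t))\<^sup>2 + ?W t * (cmod (?f t))\<^sup>2" for t
  proof -
    have "0 \<le> (cmod (?v t) - cmod (?f t))\<^sup>2" "0 \<le> (cmod (?v t))\<^sup>2" "0 \<le> (cmod (?f t))\<^sup>2"
      by simp_all
    then have p: "cmod (?v t) * cmod (?f t) \<le> (cmod (?v t))\<^sup>2 + (cmod (?f t))\<^sup>2"
      unfolding power2_diff by linarith
    have "cmod (of_real (m t) * ?v t * ?f t) = \<bar>m t\<bar> * (cmod (?v t) * cmod (?f t))"
      by (simp add: norm_mult)
    also have "\<dots> \<le> ?W t * ((cmod (?v t))\<^sup>2 + (cmod (?f t))\<^sup>2)"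
      using p mK[of t] by (intro mult_mono) auto
    finally show ?thesis by (simp add: distrib_left)
  qed
  show J: "integrable lborel (\<lambda>t. of_real (m t) * ?v t * ?f t)"
  proof (rule Bochner_Integration.integrable_bound[OF S])
    show "(\<lambda>t. of_real (m t) * ?v t * ?f t) \<in> borel_measurable lborel" by simp
    show "AE t in lborel. cmod (of_real (m t) * ?v t * ?f t)
            \<le> norm (?W t * (cmod (?v t))\<^sup>2 + ?W t * (cmod (?f t))\<^sup>2)"
    proof (rule AE_I2)
      fix t show "cmod (of_real (m t) * ?v t * ?f t)
            \<le> norm (?W t * (cmod (?v t))\<^sup>2 + ?W t * (cmod (?f t))\<^sup>2)"
        unfolding real_norm_def by (rule order_trans[OF B abs_ge_self])
    qed
  qed
  have "cmod (\<integral>t. of_real (m t) * ?v t * ?f t \<partial>lborel)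
          \<le> (\<integral>t. cmod (of_real (m t) * ?v t * ?f t) \<partial>lborel)"
    by (rule integral_norm_bound)
  also have "\<dots> \<le> (\<integral>t. ?W t * (cmod (?v t))\<^sup>2 + ?W t * (cmod (?f t))\<^sup>2 \<partial>lborel)"
    by (rule integral_mono[OF integrable_norm[OF J] S B])
  finally show "cmod (\<integral>t. of_real (m t) * ?v t * ?f t \<partial>lborel)
      \<le> (\<integral>t. ?W t * (cmod (?v t))\<^sup>2 \<partial>lborel) + (\<integral>t. ?W t * (cmod (?f t))\<^sup>2 \<partial>lborel)"
    by (simp only: Bochner_Integration.integral_add[OF I])
qed

lemma inner_L2_mult:
  assumes "\<And>t. g (Inl (crit t)) = of_real (m t)"
  shows "inner_L2 n (\<lambda>x. g x * v x) (\<lambda>x. cnj (f x)) =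
           (\<integral>t. of_real (m t) * v (Inl (crit t)) * f (Inl (crit t)) \<partial>lborel) / of_real (4 * pi)
           + (\<Sum>i = 1..n. g (Inr i) * v (Inr i) * f (Inr i))"
  using assms by (simp add: inner_L2_def crit_integral_def)

lemma T_sharp_mult:
  assumes v: "v \<in> H_space h \<sigma> \<eta> c 1" and f: "f \<in> H_space h \<sigma> \<eta> c 1" and c: "c > 0"
  shows "T_sharp h n \<sigma> \<eta> c v f = inner_L2 n (\<lambda>x. lam_at \<sigma> x * v x) (\<lambda>x. cnj (f x))"
proof -
  let ?P = "\<lambda>m::real \<Rightarrow> real. \<lambda>t. of_real (m t) * v (Inl (crit t)) * f (Inl (crit t))"
  have W: "weight \<sigma> c 1 v = (\<lambda>x. (of_real c - lam_at \<sigma> x) * v x)"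
    by (auto simp: weight_def fun_eq_iff)
  have lam: "lam (crit t) = of_real (- 1/4 - t\<^sup>2)" for t
    by (simp add: lam_def crit_def complex_eq_iff power2_eq_square)
  have I1: "integrable lborel (?P (\<lambda>t. c))"
    by (rule H1_integrable(1)[OF v f c]) (use c in \<open>auto\<close>)
  have I2: "integrable lborel (?P (\<lambda>t. c + 1/4 + t\<^sup>2))"
    by (rule H1_integrable(1)[OF v f c]) (use c in \<open>auto intro!: continuous_intros\<close>)
  have A: "of_real c * inner_L2 n v (\<lambda>x. cnj (f x)) =
      (\<integral>t. ?P (\<lambda>t. c) t \<partial>lborel) / of_real (4 * pi) + (\<Sum>i = 1..n. of_real c * v (Inr i) * f (Inr i))"
    using inner_L2_mult[of "\<lambda>x. 1" "\<lambda>t. 1" n v f]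
    by (simp add: distrib_left sum_distrib_left mult.assoc)
  have B: "inner_H n \<sigma> c 1 v (\<lambda>x. cnj (f x)) =
      (\<integral>t. ?P (\<lambda>t. c + 1/4 + t\<^sup>2) t \<partial>lborel) / of_real (4 * pi)
      + (\<Sum>i = 1..n. (of_real c - lam_at \<sigma> (Inr i)) * v (Inr i) * f (Inr i))"
    unfolding inner_H_def W
    by (rule inner_L2_mult) (simp add: lam_at_def c_minus_lam_crit)
  have C: "inner_L2 n (\<lambda>x. lam_at \<sigma> x * v x) (\<lambda>x. cnj (f x)) =
      (\<integral>t. ?P (\<lambda>t. - 1/4 - t\<^sup>2) t \<partial>lborel) / of_real (4 * pi)
      + (\<Sum>i = 1..n. lam_at \<sigma> (Inr i) * v (Inr i) * f (Inr i))"
    by (rule inner_L2_mult) (simp add: lam_at_def lam)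
  have D: "(\<integral>t. ?P (\<lambda>t. c) t \<partial>lborel) - (\<integral>t. ?P (\<lambda>t. c + 1/4 + t\<^sup>2) t \<partial>lborel)
             = (\<integral>t. ?P (\<lambda>t. - 1/4 - t\<^sup>2) t \<partial>lborel)"
    unfolding Bochner_Integration.integral_diff[OF I1 I2, symmetric]
    by (rule Bochner_Integration.integral_cong) (auto simp: algebra_simps)
  have "T_sharp h n \<sigma> \<eta> c v f
          = of_real c * inner_L2 n v (\<lambda>x. cnj (f x)) - inner_H n \<sigma> c 1 v (\<lambda>x. cnj (f x))"
    using f by (simp add: T_sharp_def to_dual_def)
  also have "\<dots> = inner_L2 n (\<lambda>x. lam_at \<sigma> x * v x) (\<lambda>x. cnj (f x))"
    unfolding A B C D[symmetric]
    by (simp add: diff_divide_distrib sum_subtractf algebra_simps)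
  finally show ?thesis .
qed

lemma H1_add:
  assumes f: "f \<in> H_space h \<sigma> \<eta> c 1" and g: "g \<in> H_space h \<sigma> \<eta> c 1" and c: "c > 0"
  shows "(\<lambda>x. f x + g x) \<in> H_space h \<sigma> \<eta> c 1"
proof -
  let ?a = "\<lambda>t. weight \<sigma> c (1/2) f (Inl (crit t))" and ?b = "\<lambda>t. weight \<sigma> c (1/2) g (Inl (crit t))"
  have [measurable]: "?a \<in> borel_measurable lborel" "?b \<in> borel_measurable lborel"
    and I: "integrable lborel (\<lambda>t. (cmod (?a t))\<^sup>2)" "integrable lborel (\<lambda>t. (cmod (?b t))\<^sup>2)"
    using f g by (auto simp: H_space_def L2_crit_def)
  have w: "weight \<sigma> c (1/2) (\<lambda>x. f x + g x) = (\<lambda>x. weight \<sigma> c (1/2) f x + weight \<sigma> c (1/2) g x)"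
    by (auto simp: weight_def fun_eq_iff distrib_left)
  have "integrable lborel (\<lambda>t. (cmod (?a t + ?b t))\<^sup>2)"
  proof (rule Bochner_Integration.integrable_bound)
    show "integrable lborel (\<lambda>t. 2 * (cmod (?a t))\<^sup>2 + 2 * (cmod (?b t))\<^sup>2)"
      using I by simp
    show "AE t in lborel. norm ((cmod (?a t + ?b t))\<^sup>2) \<le> norm (2 * (cmod (?a t))\<^sup>2 + 2 * (cmod (?b t))\<^sup>2)"
    proof (rule AE_I2)
      fix t
      have "(cmod (?a t + ?b t))\<^sup>2 \<le> (cmod (?a t) + cmod (?b t))\<^sup>2"
        by (intro power_mono norm_triangle_ineq) auto
      also have "\<dots> \<le> 2 * (cmod (?a t))\<^sup>2 + 2 * (cmod (?b t))\<^sup>2"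
        using zero_le_power2[of "cmod (?a t) - cmod (?b t)"]
        unfolding power2_diff power2_sum by linarith
      finally show "norm ((cmod (?a t + ?b t))\<^sup>2) \<le> norm (2 * (cmod (?a t))\<^sup>2 + 2 * (cmod (?b t))\<^sup>2)"
        by simp
    qed
  qed simp
  then have "L2_crit (\<lambda>s. weight \<sigma> c (1/2) (\<lambda>x. f x + g x) (Inl s))"
    unfolding w L2_crit_def by simp
  moreover have "AE t in lborel. f (Inl (1 - crit t)) + g (Inl (1 - crit t))
      = of_real \<eta> * (f (Inl (crit t)) + g (Inl (crit t))) / c_fun h (crit t)"
  proof -
    have "AE t in lborel. f (Inl (1 - crit t)) = of_real \<eta> * f (Inl (crit t)) / c_fun h (crit t)"
      "AE t in lborel. g (Inl (1 - crit t)) = of_real \<eta> * g (Inl (crit t)) / c_fun h (crit t)"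
      using f g by (simp_all add: H_space_def)
    then show ?thesis
      by eventually_elim (simp add: distrib_left add_divide_distrib)
  qed
  ultimately show ?thesis
    using f g by (auto simp: H_space_def)
qed

lemma H1_scale:
  assumes f: "f \<in> H_space h \<sigma> \<eta> c 1"
  shows "(\<lambda>x. a * f x) \<in> H_space h \<sigma> \<eta> c 1"
proof -
  have w: "weight \<sigma> c (1/2) (\<lambda>x. a * f x) = (\<lambda>x. a * weight \<sigma> c (1/2) f x)"
    by (auto simp: weight_def fun_eq_iff)
  have "AE t in lborel. a * f (Inl (1 - crit t))
      = of_real \<eta> * (a * f (Inl (crit t))) / c_fun h (crit t)"
  proof -
    have "AE t in lborel. f (Inl (1 - crit t)) = of_real \<eta> * f (Inl (crit t)) / c_fun h (crit t)"
      using f by (simp add: H_space_def)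
    then show ?thesis
      by eventually_elim simp
  qed
  then show ?thesis
    using f by (auto simp: H_space_def L2_crit_def w norm_mult power_mult_distrib)
qed

lemma norm_H_sq:
  assumes f: "f \<in> H_space h \<sigma> \<eta> c 1" and c: "c > 0"
  shows "Re (inner_H n \<sigma> c 1 f f) =
     (\<integral>t. (c + 1/4 + t\<^sup>2) * (cmod (f (Inl (crit t))))\<^sup>2 \<partial>lborel) / (4 * pi)
     + (\<Sum>i = 1..n. (c - \<sigma> i * (\<sigma> i - 1)) * (cmod (f (Inr i)))\<^sup>2)"
proof -
  have z: "z * cnj z = of_real ((cmod z)\<^sup>2)" for z
    by (rule complex_norm_square[symmetric])
  have "inner_H n \<sigma> c 1 f f = 
     (\<integral>t. of_real ((c + 1/4 + t\<^sup>2) * (cmod (f (Inl (crit t))))\<^sup>2) \<partial>lborel) / of_real (4 * pi)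
     + (\<Sum>i = 1..n. of_real ((c - \<sigma> i * (\<sigma> i - 1)) * (cmod (f (Inr i)))\<^sup>2))"
    unfolding inner_H_def inner_L2_def crit_integral_def weight_def
    by (simp add: mult.assoc z lam_at_def c_minus_lam_crit del: of_real_add of_real_power)
       (simp add: lam_def)
  also have "\<dots> = of_real ((\<integral>t. (c + 1/4 + t\<^sup>2) * (cmod (f (Inl (crit t))))\<^sup>2 \<partial>lborel) / (4 * pi)
     + (\<Sum>i = 1..n. (c - \<sigma> i * (\<sigma> i - 1)) * (cmod (f (Inr i)))\<^sup>2))"
    by (simp only: integral_complex_of_real of_real_add of_real_divide of_real_sum)
  finally show ?thesis by simp
qed

lemma T_sharp_in_dual:
  assumes v: "v \<in> H_space h \<sigma> \<eta> c 1" and c: "c > 0"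
    and pos: "\<And>i. i \<in> {1..n} \<Longrightarrow> \<sigma> i * (\<sigma> i - 1) < c"
  shows "T_sharp h n \<sigma> \<eta> c v \<in> H_dual h n \<sigma> \<eta> c"
proof -
  let ?H = "H_space h \<sigma> \<eta> c 1" and ?F = "T_sharp h n \<sigma> \<eta> c v"
  let ?W = "\<lambda>t::real. c + 1/4 + t\<^sup>2"
  let ?m = "\<lambda>t::real. - 1/4 - t\<^sup>2"
  let ?l = "\<lambda>i. \<sigma> i * (\<sigma> i - 1)"
  let ?I = "\<lambda>f. (\<integral>t. of_real (?m t) * v (Inl (crit t)) * f (Inl (crit t)) \<partial>lborel)"
  define N where "N f = Re (inner_H n \<sigma> c 1 f f)" for f
  have lam: "lam (crit t) = of_real (?m t)" for t
    by (simp add: lam_def crit_def complex_eq_iff power2_eq_square)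
  have F: "?F f = ?I f / of_real (4 * pi) + (\<Sum>i = 1..n. of_real (?l i) * v (Inr i) * f (Inr i))"
    if "f \<in> ?H" for f
    unfolding T_sharp_mult[OF v that c]
    by (subst inner_L2_mult[where m = ?m]) (simp add: lam_at_def lam, simp add: lam_at_def lam_def)
  have mW: "\<bar>?m t\<bar> \<le> ?W t" for t
    using c zero_le_power2[of t] by linarith
  have mc: "continuous_on UNIV ?m" by (intro continuous_intros)
  note int = H1_integrable[OF v _ c mc mW]
  have add: "?F (\<lambda>x. f x + g x) = ?F f + ?F g" if "f \<in> ?H" "g \<in> ?H" for f g
  proof -
    have "?I (\<lambda>x. f x + g x) = ?I f + ?I g"
      using Bochner_Integration.integral_add[OF int(1)[OF that(1)] int(1)[OF that(2)]]
      by (simp add: distrib_left)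
    then show ?thesis
      by (simp only: F[OF that(1)] F[OF that(2)] F[OF H1_add[OF that c]])
         (simp add: add_divide_distrib distrib_left sum.distrib)
  qed
  have scale: "?F (\<lambda>x. a * f x) = a * ?F f" if "f \<in> ?H" for f a
  proof -
    have "?I (\<lambda>x. a * f x) = (\<integral>t. a * (of_real (?m t) * v (Inl (crit t)) * f (Inl (crit t))) \<partial>lborel)"
      by (rule Bochner_Integration.integral_cong) auto
    then have "?I (\<lambda>x. a * f x) = a * ?I f" by simp
    then show ?thesis
      by (simp only: F[OF that] F[OF H1_scale[OF that]])
         (simp add: distrib_left sum_distrib_left mult_ac)
  qed
  define K where "K = 1 + (\<Sum>i = 1..n. \<bar>?l i\<bar> / (c - ?l i))"
  have K1: "K \<ge> 1"
    unfolding K_def using pos by (auto intro!: sum_nonneg divide_nonneg_nonneg simp: less_imp_le)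
  have Ki: "\<bar>?l i\<bar> \<le> K * (c - ?l i)" if "i \<in> {1..n}" for i
  proof -
    have "\<bar>?l i\<bar> / (c - ?l i) \<le> (\<Sum>i = 1..n. \<bar>?l i\<bar> / (c - ?l i))"
      using that pos by (intro member_le_sum) (auto intro!: divide_nonneg_nonneg simp: less_imp_le)
    then have "\<bar>?l i\<bar> / (c - ?l i) \<le> K" by (simp add: K_def)
    then show ?thesis using pos[OF that] by (simp add: pos_divide_le_eq)
  qed
  have N: "N f = (\<integral>t. ?W t * (cmod (f (Inl (crit t))))\<^sup>2 \<partial>lborel) / (4 * pi)
             + (\<Sum>i = 1..n. (c - ?l i) * (cmod (f (Inr i)))\<^sup>2)" if "f \<in> ?H" for f
    unfolding N_def by (rule norm_H_sq[OF that c])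
  have N0: "N f \<ge> 0" if "f \<in> ?H" for f
    unfolding N[OF that] using c pos
    by (intro add_nonneg_nonneg divide_nonneg_nonneg sum_nonneg mult_nonneg_nonneg integral_nonneg_AE)
       (auto simp: less_imp_le)
  have Nscale: "N (\<lambda>x. of_real r * f x) = r\<^sup>2 * N f" if "f \<in> ?H" for f r
  proof -
    have "(\<integral>t. ?W t * (cmod (of_real r * f (Inl (crit t))))\<^sup>2 \<partial>lborel)
            = (\<integral>t. r\<^sup>2 * (?W t * (cmod (f (Inl (crit t))))\<^sup>2) \<partial>lborel)"
      by (rule Bochner_Integration.integral_cong) (auto simp: norm_mult power_mult_distrib)
    then have 1: "(\<integral>t. ?W t * (cmod (of_real r * f (Inl (crit t))))\<^sup>2 \<partial>lborel)
            = r\<^sup>2 * (\<integral>t. ?W t * (cmod (f (Inl (crit t))))\<^sup>2 \<partial>lborel)"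
      by (simp only: integral_mult_right_zero)
    have 2: "(\<Sum>i = 1..n. (c - ?l i) * (cmod (of_real r * f (Inr i)))\<^sup>2)
            = r\<^sup>2 * (\<Sum>i = 1..n. (c - ?l i) * (cmod (f (Inr i)))\<^sup>2)"
      unfolding sum_distrib_left
      by (rule sum.cong) (auto simp: norm_mult power_mult_distrib)
    show ?thesis
      unfolding N[OF that] N[OF H1_scale[OF that]] 1 2 distrib_left
      by simp
  qed
  have bound: "cmod (?F f) \<le> K * N v + K * N f" if f: "f \<in> ?H" for f
  proof -
    let ?Q = "\<lambda>f. \<integral>t. ?W t * (cmod (f (Inl (crit t))))\<^sup>2 \<partial>lborel"
    have Q: "?Q g \<ge> 0" for g :: "point \<Rightarrow> complex"
      using c by (intro integral_nonneg_AE) auto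
    have "cmod (?I f / of_real (4 * pi)) \<le> (?Q v + ?Q f) / (4 * pi)"
      using int(2)[OF f] by (simp add: norm_divide divide_right_mono)
    also have "\<dots> \<le> K * ((?Q v + ?Q f) / (4 * pi))"
      using K1 Q[of v] Q[of f] mult_right_mono[of 1 K "(?Q v + ?Q f) / (4 * pi)"] by simp
    finally have 1: "cmod (?I f / of_real (4 * pi)) \<le> K * ((?Q v + ?Q f) / (4 * pi))" .
    have "cmod (\<Sum>i = 1..n. of_real (?l i) * v (Inr i) * f (Inr i))
            \<le> (\<Sum>i = 1..n. K * ((c - ?l i) * (cmod (v (Inr i)))\<^sup>2 + (c - ?l i) * (cmod (f (Inr i)))\<^sup>2))"
    proof (rule sum_norm_le)
      fix i assume i: "i \<in> {1..n}"
      let ?a = "cmod (v (Inr i))" and ?b = "cmod (f (Inr i))"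
      have p: "?a * ?b \<le> ?a\<^sup>2 + ?b\<^sup>2"
        using zero_le_power2[of "?a - ?b"] zero_le_power2[of ?a] zero_le_power2[of ?b]
        unfolding power2_diff by linarith
      have "cmod (of_real (?l i) * v (Inr i) * f (Inr i)) = \<bar>?l i\<bar> * (?a * ?b)"
        by (simp only: norm_mult norm_of_real mult.assoc)
      also have "\<dots> \<le> (K * (c - ?l i)) * (?a\<^sup>2 + ?b\<^sup>2)"
        using Ki[OF i] p by (intro mult_mono) auto
      finally show "cmod (of_real (?l i) * v (Inr i) * f (Inr i))
          \<le> K * ((c - ?l i) * ?a\<^sup>2 + (c - ?l i) * ?b\<^sup>2)"
        by (simp only: mult.assoc distrib_left)
    qed
    then have 2: "cmod (\<Sum>i = 1..n. of_real (?l i) * v (Inr i) * f (Inr i))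
        \<le> K * ((\<Sum>i = 1..n. (c - ?l i) * (cmod (v (Inr i)))\<^sup>2)
               + (\<Sum>i = 1..n. (c - ?l i) * (cmod (f (Inr i)))\<^sup>2))"
      by (simp only: sum_distrib_left[symmetric] sum.distrib)
    have "cmod (?F f) \<le> cmod (?I f / of_real (4 * pi))
            + cmod (\<Sum>i = 1..n. of_real (?l i) * v (Inr i) * f (Inr i))"
      unfolding F[OF f] by (rule norm_triangle_ineq)
    also have "\<dots> \<le> K * N v + K * N f"
      unfolding N[OF v] N[OF f] using 1 2
      by (simp only: add_divide_distrib distrib_left)
    finally show ?thesis .
  qed
  have "cmod (?F f) \<le> (K * N v + K) * norm_H n \<sigma> c 1 f" if f: "f \<in> ?H" for f
  proof -
    have rb: "\<bar>r\<bar> * cmod (?F f) \<le> K * N v + K * (r\<^sup>2 * N f)" for r :: real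
      using bound[OF H1_scale[OF f, of "of_real r"]]
      by (simp add: scale[OF f] Nscale[OF f] norm_mult)
    show ?thesis
    proof (cases "N f = 0")
      case True
      have "cmod (?F f) = 0"
      proof (rule ccontr)
        assume "cmod (?F f) \<noteq> 0"
        then show False
          using rb[of "(K * N v + 1) / cmod (?F f)"] True K1 N0[OF v]
          by (simp add: abs_of_nonneg)
      qed
      then show ?thesis
        using True by (simp add: norm_H_def flip: N_def)
    next
      case False
      then have s: "sqrt (N f) > 0" using N0[OF f] by simp
      have "cmod (?F f) / sqrt (N f) \<le> K * N v + K"
        using rb[of "1 / sqrt (N f)"] s N0[OF f] False by (simp add: power_divide)
      then show ?thesis
        using s by (simp add: norm_H_def pos_divide_le_eq flip: N_def)
    qed
  qed
  then show ?thesis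
    using add scale unfolding H_dual_def by (auto simp: T_sharp_def)
qed

end

theory Submission
  imports Defs "HOL-Probability.Sinc_Integral"
begin

text \<open>
  Since \<open>h\<close> is real on the real axis, \<open>h (cnj s) = cnj (h s)\<close>, so on the line \<open>Re s = 1/2\<close>
  the function \<open>c\<^sub>s\<close> is analytic and unimodular, with \<open>c\<^bsub>1-s\<^esub> = cnj c\<^sub>s\<close>. The equation says that
  \<open>g = (\<lambda> - \<lambda>\<^sub>w) u - \<theta>\<close> pairs to zero with all of \<open>H\<^sup>1\<close>. Point masses give \<open>g(\<tau>\<^sub>i) = 0\<close>. On the
  line \<open>g\<close> has the symmetry of \<open>H\<^sup>1\<close>, and therefore so has \<open>\<phi> c\<^sub>s cnj g\<close> for every real \<open>\<phi>\<close>
  invariant under \<open>s \<mapsto> 1 - s\<close>. As the pairing is bilinear, taking \<open>\<phi> = \<rho> Re c\<^sub>s\<close> with a positive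
  damping factor \<open>\<rho>\<close> and passing to real parts gives \<open>\<integral> \<rho> (Re c\<^sub>s)\<^sup>2 \<bar>g\<bar>\<^sup>2 = 0\<close>. Since \<open>c\<^sub>s\<close> is real
  at \<open>s = 1/2\<close>, it takes the values \<open>\<plusminus>\<i>\<close> only on a discrete set, so \<open>g = 0\<close> almost everywhere,
  i.e. \<open>u = \<theta> / (\<lambda> - \<lambda>\<^sub>w)\<close>. This function is square-integrable near \<open>w\<close> only if \<open>\<theta>(w) = 0\<close>.
  Conversely, a zero of \<open>\<theta>\<close> at \<open>w\<close> comes with one at \<open>1 - w\<close>, so \<open>\<lambda> - \<lambda>\<^sub>w = (s - w) (s - (1 - w))\<close>
  divides \<open>\<theta>\<close>, provided that the zero is double when \<open>w = 1/2\<close>; the quotient is continuous, and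
  it decays like \<open>\<bar>s\<bar>\<^bsup>-2\<^esup>\<close> because \<open>\<theta>\<close> is bounded on the line.
\<close>

section \<open>Functions on the real line\<close>

lemma bounded_range_if_eventually_bounded:
  fixes f :: "'a::{real_normed_vector, heine_borel} \<Rightarrow> 'b::real_normed_vector"
  assumes cont: "continuous_on UNIV f" and bound: "\<forall>\<^sub>F x in at_infinity. norm (f x) \<le> B"
  shows "bounded (range f)"
proof -
  obtain r where far: "\<And>x. r \<le> norm x \<Longrightarrow> norm (f x) \<le> B"
    using bound by (auto simp: eventually_at_infinity)
  have "bounded (f ` cball 0 r)"
    by (intro compact_imp_bounded compact_continuous_image continuous_on_subset[OF cont]) auto
  moreover have "range f \<subseteq> f ` cball 0 r \<union> cball 0 B"
  proof
    fix y assume "y \<in> range f"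
    then obtain x where "y = f x" by blast
    then show "y \<in> f ` cball 0 r \<union> cball 0 B"
      using far[of x] by (cases "r \<le> norm x") auto
  qed
  ultimately show ?thesis
    using bounded_subset by (metis bounded_Un bounded_cball)
qed

lemma integrable_inverse_one_plus_square: "integrable lborel (\<lambda>t::real. inverse (1 + t\<^sup>2))"
  using integrable_inverse_1_plus_square by (simp add: set_integrable_def)

lemma integrable_weighted_square_if_decay:
  fixes f :: "real \<Rightarrow> 'a::real_normed_vector"
  assumes [measurable]: "f \<in> borel_measurable borel"
    and decay: "\<And>t. norm (f t) \<le> K * inverse (1 + t\<^sup>2)" and "b \<ge> 0"
  shows "integrable lborel (\<lambda>t. (b + t\<^sup>2) * (norm (f t))\<^sup>2)"
proof -
  have bound: "(b + t\<^sup>2) * (norm (f t))\<^sup>2 \<le> (b + 1) * K\<^sup>2 * inverse (1 + t\<^sup>2)" for t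
  proof -
    have "b + t\<^sup>2 \<le> (b + 1) * (1 + t\<^sup>2)"
      using \<open>b \<ge> 0\<close> by (simp add: algebra_simps)
    moreover have "(norm (f t))\<^sup>2 \<le> (K * inverse (1 + t\<^sup>2))\<^sup>2"
      using decay by (intro power_mono) auto
    ultimately have "(b + t\<^sup>2) * (norm (f t))\<^sup>2 \<le> ((b + 1) * (1 + t\<^sup>2)) * (K * inverse (1 + t\<^sup>2))\<^sup>2"
      using \<open>b \<ge> 0\<close> by (intro mult_mono) auto
    also have "\<dots> = (b + 1) * K\<^sup>2 * ((1 + t\<^sup>2) * inverse (1 + t\<^sup>2)) * inverse (1 + t\<^sup>2)"
      by (simp only: power_mult_distrib power2_eq_square mult_ac)
    also have "(1 + t\<^sup>2) * inverse (1 + t\<^sup>2) = 1"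
      by (intro right_inverse) (metis sum_power2_eq_zero_iff one_power2 zero_neq_one)
    finally show ?thesis by simp
  qed
  show ?thesis
  proof (rule Bochner_Integration.integrable_bound)
    show "integrable lborel (\<lambda>t. (b + 1) * K\<^sup>2 * inverse (1 + t\<^sup>2))"
      by (intro integrable_mult_right integrable_inverse_one_plus_square)
    show "AE t in lborel. norm ((b + t\<^sup>2) * (norm (f t))\<^sup>2) \<le> norm ((b + 1) * K\<^sup>2 * inverse (1 + t\<^sup>2))"
      using bound \<open>b \<ge> 0\<close> by (intro AE_I2) (simp add: order_trans[OF _ abs_ge_self])
  qed measurable
qed

lemma integrable_if_weighted_square_integrable:
  fixes f :: "real \<Rightarrow> 'a::{banach, second_countable_topology}"
  assumes [measurable]: "f \<in> borel_measurable borel" and "b > 0"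
    and weighted: "integrable lborel (\<lambda>t. (b + t\<^sup>2) * (norm (f t))\<^sup>2)"
  shows "integrable lborel f"
proof (rule Bochner_Integration.integrable_bound)
  let ?bound = "\<lambda>t. inverse (1 + t\<^sup>2) + (1 + 1 / b) * ((b + t\<^sup>2) * (norm (f t))\<^sup>2)"
  show "integrable lborel ?bound"
    using weighted by (intro Bochner_Integration.integrable_add integrable_mult_right
        integrable_inverse_one_plus_square)
  have "norm (f t) \<le> ?bound t" for t
  proof -
    have pos: "1 + t\<^sup>2 > 0" by (simp add: add_pos_nonneg)
    \<comment> \<open>AM-GM for \<open>1 / (1 + t\<^sup>2)\<close> and \<open>(1 + t\<^sup>2) \<bar>f t\<bar>\<^sup>2\<close>\<close>
    have "0 \<le> (1 - (1 + t\<^sup>2) * norm (f t))\<^sup>2 / (1 + t\<^sup>2) + (1 + t\<^sup>2) * (norm (f t))\<^sup>2 + inverse (1 + t\<^sup>2)"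
      using pos by (simp add: add_nonneg_nonneg)
    also have "\<dots> = 2 * (inverse (1 + t\<^sup>2) + (1 + t\<^sup>2) * (norm (f t))\<^sup>2 - norm (f t))"
      using pos by (simp add: field_simps power2_eq_square)
    finally have "norm (f t) \<le> inverse (1 + t\<^sup>2) + (1 + t\<^sup>2) * (norm (f t))\<^sup>2" by simp
    also have "1 + t\<^sup>2 \<le> (1 + 1 / b) * (b + t\<^sup>2)"
      using \<open>b > 0\<close> by (simp add: field_simps)
    then have "(1 + t\<^sup>2) * (norm (f t))\<^sup>2 \<le> (1 + 1 / b) * ((b + t\<^sup>2) * (norm (f t))\<^sup>2)"
      by (metis mult.assoc mult_right_mono zero_le_power2)
    finally show ?thesis by simp
  qed
  then show "AE t in lborel. norm (f t) \<le> norm (?bound t)"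
    by (intro AE_I2) (metis abs_ge_self order_trans real_norm_def)
qed measurable

lemma lower_bound_square_le_square_integral_quotient:
  fixes g v :: "real \<Rightarrow> 'a::real_normed_vector"
  assumes integrable: "integrable lborel (\<lambda>t. (norm (v t))\<^sup>2)"
    and quotient: "AE t in lborel. g t = (t - a) *\<^sub>R v t"
    and "e > 0" and "\<delta> \<ge> 0" and large: "\<And>t. t \<in> {a..a + e} \<Longrightarrow> \<delta> \<le> norm (g t)"
  shows "\<delta>\<^sup>2 \<le> e * (\<integral>t. (norm (v t))\<^sup>2 \<partial>lborel)"
proof -
  have "(\<integral>t. \<delta>\<^sup>2 * indicator {a..a + e} t \<partial>lborel) \<le> (\<integral>t. e\<^sup>2 * (norm (v t))\<^sup>2 \<partial>lborel)"
  proof (rule integral_mono_AE)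
    show "AE t in lborel. \<delta>\<^sup>2 * indicator {a..a + e} t \<le> e\<^sup>2 * (norm (v t))\<^sup>2"
      using quotient
    proof eventually_elim
      case (elim t)
      have "\<delta> \<le> e * norm (v t)" if "t \<in> {a..a + e}"
      proof -
        have "\<delta> \<le> \<bar>t - a\<bar> * norm (v t)"
          using large[OF that] by (simp add: elim)
        also have "\<dots> \<le> e * norm (v t)"
          using that by (intro mult_right_mono) auto
        finally show ?thesis .
      qed
      then show ?case
        using \<open>\<delta> \<ge> 0\<close> by (auto simp: indicator_def simp flip: power_mult_distrib intro!: power_mono)
    qed
  qed (use integrable \<open>e > 0\<close> in auto)
  then have "e * \<delta>\<^sup>2 \<le> e * (e * (\<integral>t. (norm (v t))\<^sup>2 \<partial>lborel))"
    using \<open>e > 0\<close> by (simp add: power2_eq_square mult_ac)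
  then show ?thesis using \<open>e > 0\<close> by simp
qed

lemma isCont_eq_zero_if_square_integrable_quotient:
  fixes g v :: "real \<Rightarrow> 'a::real_normed_vector"
  assumes cont: "isCont g a" and integrable: "integrable lborel (\<lambda>t. (norm (v t))\<^sup>2)"
    and quotient: "AE t in lborel. g t = (t - a) *\<^sub>R v t"
  shows "g a = 0"
proof (rule ccontr)
  assume "g a \<noteq> 0"
  define \<delta> where "\<delta> = norm (g a) / 2"
  have \<delta>_pos: "\<delta> > 0" using \<open>g a \<noteq> 0\<close> by (simp add: \<delta>_def)
  obtain r where r_pos: "r > 0" and near: "\<And>t. \<bar>t - a\<bar> < r \<Longrightarrow> norm (g t - g a) < \<delta>"
    using cont \<delta>_pos unfolding continuous_at_eps_delta by (auto simp: dist_norm)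
  have large: "\<delta> \<le> norm (g t)" if "\<bar>t - a\<bar> < r" for t
    using near[OF that] norm_triangle_ineq2[of "g a" "g t"]
    by (simp add: \<delta>_def norm_minus_commute)
  define I where "I = (\<integral>t. (norm (v t))\<^sup>2 \<partial>lborel)"
  have shrink: "\<delta>\<^sup>2 \<le> e * I" if "0 < e" "e < r" for e
    unfolding I_def using that \<delta>_pos
    by (intro lower_bound_square_le_square_integral_quotient[OF integrable quotient] large) auto
  have "\<forall>\<^sub>F e in at_right 0. \<delta>\<^sup>2 \<le> e * I"
    using eventually_at_right_real[OF r_pos] by eventually_elim (use shrink in auto)
  moreover have "((\<lambda>e. e * I) \<longlongrightarrow> 0 * I) (at_right 0)"
    by (intro tendsto_intros)
  ultimately have "\<delta>\<^sup>2 \<le> 0 * I"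
    by (intro tendsto_lowerbound[where F = "at_right 0"]) auto
  then show False using \<delta>_pos by simp
qed

definition damping :: "(real \<Rightarrow> 'a::real_normed_vector) \<Rightarrow> real \<Rightarrow> real" where
  "damping g t = inverse (1 + (norm (g t))\<^sup>2) * inverse (1 + t\<^sup>2)"

lemma damping_pos: "damping g t > 0"
  by (simp add: damping_def add_pos_nonneg)

lemma damping_measurable [measurable]:
  assumes [measurable]: "g \<in> borel_measurable borel"
  shows "damping g \<in> borel_measurable borel"
  unfolding damping_def[abs_def] by measurable

lemma damping_mult_norm_le: "damping g t * norm (g t) \<le> inverse (1 + t\<^sup>2)"
proof -
  have "norm (g t) \<le> 1 + (norm (g t))\<^sup>2"
    using zero_le_power2[of "norm (g t) - 1"] norm_ge_zero[of "g t"]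
    unfolding power2_diff one_power2 by linarith
  then have "inverse (1 + (norm (g t))\<^sup>2) * norm (g t) \<le> 1"
    by (simp add: inverse_eq_divide divide_le_eq add_pos_nonneg)
  then have "inverse (1 + (norm (g t))\<^sup>2) * norm (g t) * inverse (1 + t\<^sup>2) \<le> 1 * inverse (1 + t\<^sup>2)"
    by (intro mult_right_mono) auto
  then show ?thesis
    by (simp add: damping_def mult_ac)
qed

lemma eventually_one_plus_square_le:
  "\<forall>\<^sub>F t::real in at_infinity. 1 + t\<^sup>2 \<le> 2 * \<bar>b\<^sup>2 - t\<^sup>2\<bar>"
proof -
  have "1 + t\<^sup>2 \<le> 2 * \<bar>b\<^sup>2 - t\<^sup>2\<bar>" if "1 + 2 * b\<^sup>2 \<le> \<bar>t\<bar>" for t :: real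
  proof -
    have "(1 + 2 * b\<^sup>2) * 1 \<le> \<bar>t\<bar> * \<bar>t\<bar>"
      using that zero_le_power2[of b] by (intro mult_mono) linarith+
    then have "1 + 2 * b\<^sup>2 \<le> t\<^sup>2"
      by (simp add: power2_eq_square)
    then show ?thesis
      using abs_ge_minus_self[of "b\<^sup>2 - t\<^sup>2"] by simp
  qed
  then show ?thesis by (auto simp: eventually_at_infinity)
qed

lemma AE_lborel_if_countable:
  fixes P :: "'a::euclidean_space \<Rightarrow> bool"
  assumes "countable {x. \<not> P x}"
  shows "AE x in lborel. P x"
  by (rule AE_I'[OF countable_imp_null_set_lborel[OF assms]]) simp

section \<open>Zeros and reflections of meromorphic functions\<close>

lemma analytic_on_factor_zero:
  assumes analytic: "f analytic_on S" and zero: "f z = 0"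
  obtains g where "g analytic_on S" "g z = deriv f z" "\<And>s. f s = (s - z) * g s"
proof
  let ?g = "\<lambda>s. if s = z then deriv f z else (f s - f z) / (s - z)"
  obtain U where U: "open U" "S \<subseteq> U" "f holomorphic_on U"
    using analytic by (auto simp: analytic_on_holomorphic)
  then have "?g holomorphic_on U"
    by (intro pole_lemma_open)
  with U show "?g analytic_on S"
    by (auto simp: analytic_on_holomorphic)
qed (use zero in auto)

lemma filterlim_cnj_at: "filterlim cnj (at (cnj z)) (at z)"
  by (auto simp: filterlim_at eventually_at_filter intro!: tendsto_intros)

lemma analytic_at_cnj_cnj:
  assumes "f analytic_on {cnj z}"
  shows "(\<lambda>z. cnj (f (cnj z))) analytic_on {z}"
proof -
  obtain U where U: "open U" "cnj z \<in> U" "f holomorphic_on U"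
    using assms by (auto simp: analytic_at)
  have open_image: "open (cnj ` U)"
    unfolding image_cnj_conv_vimage_cnj using U by (intro open_vimage continuous_intros)
  then have "cnj \<circ> f \<circ> cnj holomorphic_on cnj ` U"
    using U by (intro holomorphic_on_compose_cnj_cnj) (simp_all add: image_image)
  then show ?thesis
    using U open_image unfolding analytic_at o_def by (metis complex_cnj_cnj imageI)
qed

lemma isolated_singularity_at_cnj_cnj:
  assumes "isolated_singularity_at f (cnj z)"
  shows "isolated_singularity_at (\<lambda>z. cnj (f (cnj z))) z"
proof -
  have "\<forall>\<^sub>F z in at z. f analytic_on {cnj z}"
    using assms filterlim_cnj_at unfolding isolated_singularity_at_altdef
    by (rule eventually_compose_filterlim)
  then show ?thesis
    unfolding isolated_singularity_at_altdef by eventually_elim (rule analytic_at_cnj_cnj)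
qed

lemma not_essential_cnj_cnj:
  assumes "not_essential f (cnj z)"
  shows "not_essential (\<lambda>z. cnj (f (cnj z))) z"
proof -
  consider l where "(f \<longlongrightarrow> l) (at (cnj z))" | "is_pole f (cnj z)"
    using assms by (auto simp: not_essential_def)
  then show ?thesis
  proof cases
    case (1 l)
    then have "((\<lambda>z. cnj (f (cnj z))) \<longlongrightarrow> cnj l) (at z)"
      by (intro tendsto_cnj filterlim_compose[OF _ filterlim_cnj_at])
    then show ?thesis by (auto simp: not_essential_def)
  next
    case 2
    then have "filterlim (\<lambda>z. f (cnj z)) at_infinity (at z)"
      unfolding is_pole_def by (rule filterlim_compose[OF _ filterlim_cnj_at])
    then have "is_pole (\<lambda>z. cnj (f (cnj z))) z"
      by (simp add: is_pole_def filterlim_at_infinity_conv_norm_at_top)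
    then show ?thesis by (auto simp: not_essential_def)
  qed
qed

lemma meromorphic_on_cnj_cnj:
  assumes "f meromorphic_on cnj ` A"
  shows "(\<lambda>z. cnj (f (cnj z))) meromorphic_on A"
  using assms unfolding meromorphic_on_altdef
  by (auto intro: isolated_singularity_at_cnj_cnj not_essential_cnj_cnj)

lemma meromorphic_reflection_cosparse:
  assumes meromorphic: "f meromorphic_on UNIV" and real: "\<And>x::real. f (of_real x) \<in> \<real>"
  shows "\<forall>\<^sub>\<approx>z\<in>UNIV. f (cnj z) = cnj (f z)"
proof -
  let ?d = "\<lambda>z. f z - cnj (f (cnj z))"
  have "(\<lambda>z. cnj (f (cnj z))) meromorphic_on UNIV"
    using meromorphic by (intro meromorphic_on_cnj_cnj) (rule meromorphic_on_subset, auto)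
  then have "?d meromorphic_on UNIV"
    by (intro meromorphic_intros meromorphic)
  then have "(\<forall>\<^sub>\<approx>z\<in>UNIV. ?d z = 0) \<or> (\<forall>\<^sub>\<approx>z\<in>UNIV. ?d z \<noteq> 0)"
    by (intro meromorphic_imp_constant_or_avoid) auto
  moreover have "\<not> (\<forall>\<^sub>\<approx>z\<in>UNIV. ?d z \<noteq> 0)"
  proof
    assume "\<forall>\<^sub>\<approx>z\<in>UNIV. ?d z \<noteq> 0"
    then have "\<forall>\<^sub>F z in at 0. ?d z \<noteq> 0"
      by (rule eventually_cosparse_imp_eventually_at) auto
    moreover have "filterlim complex_of_real (at 0) (at 0)"
      by (auto simp: filterlim_at eventually_at_filter intro!: tendsto_eq_intros)
    ultimately have "\<forall>\<^sub>F x::real in at 0. ?d (of_real x) \<noteq> 0"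
      by (rule eventually_compose_filterlim)
    moreover have "?d (of_real x) = 0" for x :: real
      using real[of x] by (simp add: Reals_cnj_iff)
    ultimately show False by simp
  qed
  ultimately have "\<forall>\<^sub>\<approx>z\<in>UNIV. ?d z = 0" by blast
  then show ?thesis
    by eventually_elim (metis complex_cnj_cnj right_minus_eq)
qed

section \<open>The quotient \<open>c\<^sub>s\<close> on the critical line\<close>

lemma crit_eq_iff [simp]: "crit s = crit t \<longleftrightarrow> s = t"
  by (simp add: crit_def)

lemma Im_crit [simp]: "Im (crit t) = t"
  by (simp add: crit_def)

lemma one_minus_crit: "1 - crit t = crit (- t)"
  by (simp add: crit_def complex_eq_iff)

lemma cnj_crit: "cnj (crit t) = crit (- t)"
  by (simp add: crit_def complex_eq_iff)

lemma lam_crit: "lam (crit t) = of_real (- 1/4 - t\<^sup>2)"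
  by (simp add: lam_def crit_def complex_eq_iff power2_eq_square)

lemma lam_diff_crit: "lam s - lam (crit a) = (s - crit a) * (s - crit (- a))"
  by (simp add: lam_def flip: one_minus_crit) (simp add: algebra_simps)

lemma isCont_crit: "isCont crit t"
proof -
  have "crit = (\<lambda>t. of_real (1/2) + \<i> * of_real t)"
    by (simp add: crit_def complex_eq_iff fun_eq_iff)
  moreover have "isCont (\<lambda>t. of_real (1/2) + \<i> * complex_of_real t) t"
    by (intro continuous_intros)
  ultimately show ?thesis by simp
qed

lemma filterlim_crit: "filterlim crit (at (crit t)) (at t)"
  using isCont_crit by (simp add: filterlim_at isContD eventually_at_filter)

lemma eventually_at_crit_if_cosparse:
  assumes "\<forall>\<^sub>\<approx>z\<in>UNIV. P z"
  shows "\<forall>\<^sub>F t in at s. P (crit t)"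
  by (rule eventually_compose_filterlim[OF eventually_cosparse_imp_eventually_at filterlim_crit])
     (use assms in auto)

lemma AE_crit_if_cosparse:
  assumes "\<forall>\<^sub>\<approx>z\<in>UNIV. P z"
  shows "AE t in lborel. P (crit t)"
proof (rule AE_lborel_if_countable)
  have "countable {z. \<not> P z}"
    using sparse_imp_countable[of UNIV "{z. \<not> P z}"] assms by (simp add: eventually_cosparse)
  then have "countable (crit ` {t. \<not> P (crit t)})"
    by (rule countable_subset[rotated]) auto
  then show "countable {t. \<not> P (crit t)}"
    by (rule countable_image_inj_on) (simp add: inj_on_def)
qed

lemma nonzero_if_finite_zeros_right:
  assumes "finite (zeros_right h)"
  shows "\<exists>s. h s \<noteq> 0"
proof (rule ccontr)
  assume "\<nexists>s. h s \<noteq> 0"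
  then have "h = (\<lambda>_. 0)" by auto
  moreover have "\<not> is_pole (\<lambda>_. 0::complex) s" for s :: complex
    by (rule not_is_pole_holomorphic[of UNIV]) auto
  ultimately have "of_nat ` {1..} \<subseteq> zeros_right h"
    by (auto simp: zeros_right_def)
  then have "finite (of_nat ` {1..} :: complex set)"
    using assms finite_subset by blast
  then have "finite {1::nat..}"
    by (rule finite_imageD) (simp add: inj_on_def)
  then show False
    using infinite_Ici by blast
qed

locale real_meromorphic =
  fixes h :: "complex \<Rightarrow> complex"
  assumes nicely_meromorphic: "h nicely_meromorphic_on UNIV"
    and nonzero: "\<exists>s. h s \<noteq> 0"
    and real_on_Reals: "\<forall>x::real. h (of_real x) \<in> \<real>"
begin

definition \<kappa> :: "real \<Rightarrow> complex" where
  "\<kappa> t = c_fun h (crit t)"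

lemma meromorphic: "h meromorphic_on UNIV"
  using nicely_meromorphic by (simp add: nicely_meromorphic_on_def)

lemma c_quotient_meromorphic: "(\<lambda>s. h (1 - s) / h s) meromorphic_on UNIV"
proof -
  have "(\<lambda>s. h (1 - s)) meromorphic_on UNIV"
    by (rule meromorphic_on_compose[OF meromorphic]) (auto intro!: analytic_intros)
  then show ?thesis
    by (intro meromorphic_intros meromorphic)
qed

lemma c_fun_nicely_meromorphic: "c_fun h nicely_meromorphic_on UNIV"
  unfolding c_fun_def by (rule remove_sings_nicely_meromorphic[OF c_quotient_meromorphic])

lemma eventually_\<kappa>_eq:
  "\<forall>\<^sub>F t in at s. h (crit t) \<noteq> 0 \<and> h (crit (- t)) = cnj (h (crit t)) \<and>
     \<kappa> t = h (crit (- t)) / h (crit t)"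
proof -
  have "\<forall>\<^sub>\<approx>z\<in>UNIV. h z \<noteq> 0"
    using nicely_meromorphic_imp_constant_or_avoid[OF nicely_meromorphic, of 0] nonzero by auto
  moreover have "\<forall>\<^sub>\<approx>z\<in>UNIV. c_fun h z = h (1 - z) / h z"
    unfolding c_fun_def by (rule eventually_remove_sings_eq[OF c_quotient_meromorphic])
  moreover have "\<forall>\<^sub>\<approx>z\<in>UNIV. h (cnj z) = cnj (h z)"
    using meromorphic real_on_Reals by (intro meromorphic_reflection_cosparse) auto
  ultimately have "\<forall>\<^sub>\<approx>z\<in>UNIV. h z \<noteq> 0 \<and> c_fun h z = h (1 - z) / h z \<and> h (cnj z) = cnj (h z)"
    by eventually_elim simp
  from eventually_at_crit_if_cosparse[OF this] show ?thesis
    by eventually_elim (simp add: \<kappa>_def one_minus_crit cnj_crit)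
qed

lemma c_fun_analytic_at_crit: "c_fun h analytic_on {crit t}"
proof (rule nicely_meromorphic_on_imp_analytic_at[OF c_fun_nicely_meromorphic])
  show "\<not> is_pole (c_fun h) (crit t)"
  proof
    assume "is_pole (c_fun h) (crit t)"
    then have "filterlim \<kappa> at_infinity (at t)"
      unfolding is_pole_def \<kappa>_def[abs_def] by (rule filterlim_compose[OF _ filterlim_crit])
    then have "\<forall>\<^sub>F u in at t. cmod (\<kappa> u) \<ge> 2"
      by (simp add: filterlim_at_infinity_conv_norm_at_top filterlim_at_top)
    with eventually_\<kappa>_eq[of t] have "\<forall>\<^sub>F u in at t. False"
      by eventually_elim (simp add: norm_divide)
    then show False by simp
  qed
qed simp

lemma isCont_\<kappa>: "isCont \<kappa> t"
  unfolding \<kappa>_def[abs_def]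
  by (rule isCont_o2[OF isCont_crit analytic_at_imp_isCont[OF c_fun_analytic_at_crit]])

lemma \<kappa>_measurable [measurable]: "\<kappa> \<in> borel_measurable borel"
  by (intro borel_measurable_continuous_onI continuous_at_imp_continuous_on ballI isCont_\<kappa>)

lemma norm_\<kappa> [simp]: "cmod (\<kappa> t) = 1"
proof (rule tendsto_unique)
  show "((\<lambda>u. cmod (\<kappa> u)) \<longlongrightarrow> cmod (\<kappa> t)) (at t)"
    by (intro tendsto_norm isContD isCont_\<kappa>)
  have "\<forall>\<^sub>F u in at t. cmod (\<kappa> u) = 1"
    using eventually_\<kappa>_eq by eventually_elim (simp add: norm_divide)
  then show "((\<lambda>u. cmod (\<kappa> u)) \<longlongrightarrow> 1) (at t)"
    by (rule tendsto_eventually)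
qed simp

lemma \<kappa>_nonzero [simp]: "\<kappa> t \<noteq> 0"
  using norm_\<kappa>[of t] by force

lemma \<kappa>_mult_cnj [simp]: "\<kappa> t * cnj (\<kappa> t) = 1"
  by (simp flip: complex_norm_square)

lemma \<kappa>_minus: "\<kappa> (- t) = cnj (\<kappa> t)"
proof (rule tendsto_unique)
  show "((\<lambda>u. \<kappa> (- u)) \<longlongrightarrow> \<kappa> (- t)) (at t)"
    by (intro isContD isCont_o2[OF _ isCont_\<kappa>] continuous_intros)
  have "\<forall>\<^sub>F u in at t. \<kappa> (- u) = h (crit u) / h (crit (- u))"
    using eventually_\<kappa>_eq[of "- t"]
    by (simp add: eventually_filtermap eventually_conj_iff flip: filtermap_at_minus)
  with eventually_\<kappa>_eq[of t] have "\<forall>\<^sub>F u in at t. \<kappa> (- u) = cnj (\<kappa> u)"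
    by eventually_elim simp
  moreover have "((\<lambda>u. cnj (\<kappa> u)) \<longlongrightarrow> cnj (\<kappa> t)) (at t)"
    by (intro tendsto_cnj isContD isCont_\<kappa>)
  ultimately show "((\<lambda>u. \<kappa> (- u)) \<longlongrightarrow> cnj (\<kappa> t)) (at t)"
    by (simp cong: tendsto_cong)
qed simp

lemma AE_Re_\<kappa>_nonzero: "AE t in lborel. Re (\<kappa> t) \<noteq> 0"
proof -
  have avoid: "\<forall>\<^sub>\<approx>s\<in>UNIV. c_fun h s \<noteq> z" if "z \<notin> \<real>" for z
  proof -
    have "c_fun h (crit 0) \<noteq> z"
      using \<kappa>_minus[of 0] that by (auto simp: \<kappa>_def Reals_cnj_iff)
    then show ?thesis
      using nicely_meromorphic_imp_constant_or_avoid[OF c_fun_nicely_meromorphic, of z] by auto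
  qed
  have "AE t in lborel. c_fun h (crit t) \<noteq> \<i>" "AE t in lborel. c_fun h (crit t) \<noteq> - \<i>"
    by (intro AE_crit_if_cosparse avoid; simp add: complex_is_Real_iff)+
  then show ?thesis
  proof eventually_elim
    case (elim t)
    show ?case
    proof
      assume "Re (\<kappa> t) = 0"
      moreover from this have "Im (\<kappa> t) = 1 \<or> Im (\<kappa> t) = - 1"
        using norm_\<kappa>[of t] by (auto simp: norm_complex_def abs_if split: if_splits)
      ultimately show False
        using elim by (auto simp: \<kappa>_def complex_eq_iff)
    qed
  qed
qed

end

section \<open>The spaces \<open>H\<^sup>k\<close>\<close>

abbreviation on_line :: "(point \<Rightarrow> complex) \<Rightarrow> real \<Rightarrow> complex" where
  "on_line f t \<equiv> f (Inl (crit t))"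

definition extend_line :: "(real \<Rightarrow> complex) \<Rightarrow> point \<Rightarrow> complex" where
  "extend_line f = case_sum (\<lambda>s. f (Im s)) (\<lambda>i. 0)"

lemma extend_line_simps:
  "on_line (extend_line f) t = f t" "extend_line f (Inr i) = 0"
  by (simp_all add: extend_line_def)

lemma weight_crit:
  assumes "c > 0"
  shows "weight \<sigma> c k f (Inl (crit t)) = of_real ((c + 1/4 + t\<^sup>2) powr k) * on_line f t"
proof -
  have "c + 1/4 + t\<^sup>2 \<ge> 0"
    using assms by (simp add: add_nonneg_nonneg)
  then show ?thesis
    by (simp only: weight_def lam_at_def sum.case c_minus_lam_crit powr_of_real)
qed

lemma mem_H_space_iff:
  assumes "c > 0"
  shows "f \<in> H_space h \<sigma> \<eta> c k \<longleftrightarrow>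
    on_line f \<in> borel_measurable borel \<and>
    integrable lborel (\<lambda>t. (c + 1/4 + t\<^sup>2) powr k * (cmod (on_line f t))\<^sup>2) \<and>
    (AE t in lborel. on_line f (- t) = of_real \<eta> * on_line f t / c_fun h (crit t))"
proof -
  have "((c + 1/4 + t\<^sup>2) powr (k / 2))\<^sup>2 = (c + 1/4 + t\<^sup>2) powr k" for t
    by (simp add: power2_eq_square flip: powr_add)
  then have "(cmod (weight \<sigma> c (k / 2) f (Inl (crit t))))\<^sup>2
      = (c + 1/4 + t\<^sup>2) powr k * (cmod (on_line f t))\<^sup>2" for t
    by (simp add: weight_crit[OF assms] norm_mult power_mult_distrib)
  moreover have "(\<lambda>t. weight \<sigma> c (k / 2) f (Inl (crit t))) \<in> borel_measurable borel"
    if [measurable]: "on_line f \<in> borel_measurable borel"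
    unfolding weight_crit[OF assms] by measurable
  ultimately show ?thesis
    by (auto simp: H_space_def L2_crit_def one_minus_crit)
qed

lemma mem_H1_iff:
  assumes "c > 0"
  shows "f \<in> H_space h \<sigma> \<eta> c 1 \<longleftrightarrow>
    on_line f \<in> borel_measurable borel \<and>
    integrable lborel (\<lambda>t. (c + 1/4 + t\<^sup>2) * (cmod (on_line f t))\<^sup>2) \<and>
    (AE t in lborel. on_line f (- t) = of_real \<eta> * on_line f t / c_fun h (crit t))"
proof -
  have "(c + 1/4 + t\<^sup>2) powr 1 = c + 1/4 + t\<^sup>2" for t
    using assms by (simp add: add_nonneg_nonneg)
  then show ?thesis by (simp only: mem_H_space_iff[OF assms])
qed

lemma H1_if_decay:
  assumes "c > 0" and measurable: "on_line f \<in> borel_measurable borel"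
    and decay: "\<And>t. cmod (on_line f t) \<le> K * inverse (1 + t\<^sup>2)"
    and sym: "AE t in lborel. on_line f (- t) = of_real \<eta> * on_line f t / c_fun h (crit t)"
  shows "f \<in> H_space h \<sigma> \<eta> c 1"
  using integrable_weighted_square_if_decay[OF measurable decay, of "c + 1/4"] measurable sym \<open>c > 0\<close>
  by (simp add: mem_H1_iff)

lemma indicator_Inr_in_H_space:
  assumes "c > 0"
  shows "case_sum (\<lambda>s. 0) (\<lambda>j. if j = i then 1 else 0) \<in> H_space h \<sigma> \<eta> c k"
  using assms by (simp add: mem_H_space_iff)

lemma H1_integrable_line:
  assumes "f \<in> H_space h \<sigma> \<eta> c 1" and "c > 0"
  shows "integrable lborel (on_line f)"
proof (rule integrable_if_weighted_square_integrable[where b = "c + 1/4"])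
  show "on_line f \<in> borel_measurable borel"
    and "integrable lborel (\<lambda>t. (c + 1/4 + t\<^sup>2) * (cmod (on_line f t))\<^sup>2)"
    using assms by (simp_all add: mem_H1_iff)
qed (use \<open>c > 0\<close> in simp)

lemma H1_mult_integrable:
  assumes "v \<in> H_space h \<sigma> \<eta> c 1" "f \<in> H_space h \<sigma> \<eta> c 1" "c > 0"
  shows "integrable lborel (\<lambda>t. on_line v t * on_line f t)"
proof -
  have "integrable lborel (\<lambda>t. of_real c * on_line v t * on_line f t)"
    using assms by (intro H1_integrable(1)) auto
  then have "integrable lborel (\<lambda>t. of_real (1 / c) * (of_real c * on_line v t * on_line f t))"
    by (rule integrable_mult_right)
  then show ?thesis using \<open>c > 0\<close> by simp
qed

section \<open>The equation \<open>(T\<^sup># - \<lambda>\<^sub>w) u = \<theta>\<close>\<close>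

abbreviation pairing :: "nat \<Rightarrow> (point \<Rightarrow> complex) \<Rightarrow> (point \<Rightarrow> complex) \<Rightarrow> complex" where
  "pairing n v f \<equiv> inner_L2 n v (\<lambda>x. cnj (f x))"

lemma pairing_eq:
  "pairing n v f = (\<integral>t. on_line v t * on_line f t \<partial>lborel) / of_real (4 * pi)
     + (\<Sum>i = 1..n. v (Inr i) * f (Inr i))"
  by (simp add: inner_L2_def crit_integral_def)

lemma pairing_scale_left: "pairing n (\<lambda>x. a * v x) f = a * pairing n v f"
  by (simp add: pairing_eq mult.assoc distrib_left sum_distrib_left)

lemma pairing_diff_left:
  assumes "integrable lborel (\<lambda>t. on_line v t * on_line f t)"
    and "integrable lborel (\<lambda>t. on_line w t * on_line f t)"
  shows "pairing n (\<lambda>x. v x - w x) f = pairing n v f - pairing n w f"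
  using assms by (simp add: pairing_eq left_diff_distrib sum_subtractf diff_divide_distrib)

lemma pairing_eq_zero:
  assumes "AE t in lborel. on_line v t = 0" and "\<And>i. i \<in> {1..n} \<Longrightarrow> v (Inr i) = 0"
  shows "pairing n v f = 0"
proof -
  have "AE t in lborel. on_line v t * on_line f t = 0"
    using assms(1) by eventually_elim simp
  then show ?thesis
    using assms(2) by (simp add: pairing_eq integral_eq_zero_AE)
qed

locale critical_line = real_meromorphic h for h :: "complex \<Rightarrow> complex" +
  fixes n :: nat and \<sigma> :: "nat \<Rightarrow> real" and \<eta> c :: real
  assumes \<sigma>_gt_half: "i \<in> {1..n} \<Longrightarrow> \<sigma> i > 1/2"
    and \<eta>_sign: "\<eta> \<in> {1, -1}"
    and c_pos: "c > 0"
begin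

abbreviation H1 :: "(point \<Rightarrow> complex) set" where
  "H1 \<equiv> H_space h \<sigma> \<eta> c 1"

abbreviation \<theta> :: "point \<Rightarrow> complex" where
  "\<theta> \<equiv> theta h \<sigma> \<eta>"

abbreviation sol :: "real \<Rightarrow> point \<Rightarrow> complex" where
  "sol a \<equiv> u_sol h \<sigma> \<eta> (crit a)"

definition residual :: "real \<Rightarrow> (point \<Rightarrow> complex) \<Rightarrow> point \<Rightarrow> complex" where
  "residual a u x = (lam_at \<sigma> x - lam (crit a)) * u x - \<theta> x"

lemma abs_\<eta> [simp]: "\<bar>\<eta>\<bar> = 1"
  using \<eta>_sign by auto

lemma H1_measurable: "f \<in> H1 \<Longrightarrow> on_line f \<in> borel_measurable borel"
  using c_pos by (simp add: mem_H1_iff)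

lemma H1_symmetric: "f \<in> H1 \<Longrightarrow> AE t in lborel. on_line f (- t) = of_real \<eta> * on_line f t / \<kappa> t"
  using c_pos by (simp add: mem_H1_iff \<kappa>_def)

lemma on_line_theta: "on_line \<theta> t = 1 + of_real \<eta> * \<kappa> t"
  by (simp add: theta_def \<kappa>_def)

lemma isCont_theta: "isCont (on_line \<theta>) t"
  unfolding on_line_theta by (intro continuous_intros isCont_\<kappa>)

lemma theta_measurable [measurable]: "on_line \<theta> \<in> borel_measurable borel"
  unfolding on_line_theta by measurable

lemma norm_theta_le: "cmod (on_line \<theta> t) \<le> 2"
  unfolding on_line_theta using norm_triangle_ineq[of 1 "of_real \<eta> * \<kappa> t"] by (simp add: norm_mult)

lemma theta_minus: "on_line \<theta> (- t) = of_real \<eta> * on_line \<theta> t / \<kappa> t"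
  using \<eta>_sign unfolding on_line_theta \<kappa>_minus by (auto simp: field_simps)

lemma on_line_sol: "on_line (sol a) t = on_line \<theta> t / of_real (a\<^sup>2 - t\<^sup>2)"
  by (simp add: u_sol_def theta_def lam_crit)

lemma on_line_residual: "on_line (residual a u) t = of_real (a\<^sup>2 - t\<^sup>2) * on_line u t - on_line \<theta> t"
  by (simp add: residual_def lam_at_def lam_crit)

lemma lam_at_Inr_neq:
  assumes "i \<in> {1..n}"
  shows "lam_at \<sigma> (Inr i) \<noteq> lam (crit a)"
proof -
  have "0 < (\<sigma> i - 1/2)\<^sup>2" using \<sigma>_gt_half[OF assms] by simp
  also have "\<dots> = \<sigma> i * (\<sigma> i - 1) + 1/4"
    by (simp add: power2_eq_square algebra_simps)
  finally have "\<sigma> i * (\<sigma> i - 1) \<noteq> - 1/4 - a\<^sup>2"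
    using zero_le_power2[of a] by linarith
  moreover have "lam_at \<sigma> (Inr i) = of_real (\<sigma> i * (\<sigma> i - 1))"
    by (simp add: lam_at_def lam_def)
  ultimately show ?thesis
    unfolding lam_crit by (simp only: of_real_eq_iff not_False_eq_True)
qed

lemma residual_zero_iff_eq_sol:
  "(AE t in lborel. on_line (residual a u) t = 0) \<and> (\<forall>i\<in>{1..n}. residual a u (Inr i) = 0)
    \<longleftrightarrow> eq_H n u (sol a)"
proof -
  have "countable {t. \<not> a\<^sup>2 - t\<^sup>2 \<noteq> 0}"
    by (rule countable_subset[of _ "{a, - a}"]) (auto simp: power2_eq_iff)
  then have "AE t in lborel. a\<^sup>2 - t\<^sup>2 \<noteq> 0"
    by (rule AE_lborel_if_countable)
  then have "AE t in lborel. on_line (residual a u) t = 0 \<longleftrightarrow> on_line u t = on_line (sol a) t"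
  proof eventually_elim
    case (elim t)
    then have "complex_of_real (a\<^sup>2 - t\<^sup>2) \<noteq> 0"
      by (simp only: of_real_eq_0_iff not_False_eq_True)
    then show ?case
      by (simp only: on_line_residual on_line_sol eq_divide_eq right_minus_eq) (simp add: mult.commute)
  qed
  then have "(AE t in lborel. on_line (residual a u) t = 0) \<longleftrightarrow>
      (AE t in lborel. on_line u t = on_line (sol a) t)"
    by (rule eventually_subst)
  moreover have "residual a u (Inr i) = 0 \<longleftrightarrow> u (Inr i) = sol a (Inr i)" if "i \<in> {1..n}" for i
    using lam_at_Inr_neq[OF that, of a]
    by (simp add: residual_def u_sol_def theta_def lam_at_def eq_divide_eq mult.commute)
  ultimately show ?thesis
    unfolding eq_H_def by blast
qed

lemma residual_measurable:
  assumes "u \<in> H1"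
  shows "on_line (residual a u) \<in> borel_measurable borel"
proof -
  note H1_measurable[OF assms, measurable]
  show ?thesis unfolding on_line_residual by measurable
qed

lemma residual_symmetric:
  assumes "u \<in> H1"
  shows "AE t in lborel. on_line (residual a u) (- t) = of_real \<eta> * on_line (residual a u) t / \<kappa> t"
  using H1_symmetric[OF assms]
  by eventually_elim
     (simp add: on_line_residual theta_minus algebra_simps diff_divide_distrib add_divide_distrib)

lemma H1_lam_mult_integrable:
  assumes "u \<in> H1" "f \<in> H1"
  shows "integrable lborel (\<lambda>t. lam (crit t) * on_line u t * on_line f t)"
  unfolding lam_crit
proof (rule H1_integrable(1)[OF assms c_pos])
  show "\<bar>- 1/4 - t\<^sup>2\<bar> \<le> c + 1/4 + t\<^sup>2" for t
    using c_pos zero_le_power2[of t] by linarith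
qed (intro continuous_intros)

lemma H1_theta_mult_integrable:
  assumes "f \<in> H1"
  shows "integrable lborel (\<lambda>t. on_line \<theta> t * on_line f t)"
proof (rule Bochner_Integration.integrable_bound)
  show "integrable lborel (\<lambda>t. 2 * on_line f t)"
    using H1_integrable_line[OF assms c_pos] by simp
  note H1_measurable[OF assms, measurable]
  show "(\<lambda>t. on_line \<theta> t * on_line f t) \<in> borel_measurable lborel"
    by measurable
  show "AE t in lborel. cmod (on_line \<theta> t * on_line f t) \<le> cmod (2 * on_line f t)"
    using norm_theta_le by (intro AE_I2) (simp add: norm_mult mult_right_mono)
qed

lemma residual_mult_integrable:
  assumes "u \<in> H1" "f \<in> H1"
  shows "integrable lborel (\<lambda>t. on_line (residual a u) t * on_line f t)"
proof -
  have "integrable lborel (\<lambda>t. lam (crit t) * on_line u t * on_line f t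
      - lam (crit a) * (on_line u t * on_line f t) - on_line \<theta> t * on_line f t)"
    using assms by (intro Bochner_Integration.integrable_diff integrable_mult_right
        H1_lam_mult_integrable H1_mult_integrable[OF _ _ c_pos] H1_theta_mult_integrable)
  then show ?thesis
    by (simp add: residual_def lam_at_def algebra_simps)
qed

lemma pairing_residual:
  assumes u_in_H1: "u \<in> H1" and f_in_H1: "f \<in> H1"
  shows "pairing n (residual a u) f =
    T_sharp h n \<sigma> \<eta> c u f - lam (crit a) * to_dual h n \<sigma> \<eta> c u f - to_dual h n \<sigma> \<eta> c \<theta> f"
proof -
  note lam_integrable = H1_lam_mult_integrable[OF u_in_H1 f_in_H1]
  note uf_integrable = H1_mult_integrable[OF u_in_H1 f_in_H1 c_pos]
  have "pairing n (residual a u) f = pairing n (\<lambda>x. lam_at \<sigma> x * u x - lam (crit a) * u x - \<theta> x) f"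
    by (simp add: residual_def[abs_def] left_diff_distrib)
  also have "\<dots> = pairing n (\<lambda>x. lam_at \<sigma> x * u x - lam (crit a) * u x) f - pairing n \<theta> f"
    using Bochner_Integration.integrable_diff[OF lam_integrable integrable_mult_right[OF uf_integrable],
        of "lam (crit a)"]
    by (intro pairing_diff_left H1_theta_mult_integrable f_in_H1)
       (simp add: lam_at_def algebra_simps)
  also have "pairing n (\<lambda>x. lam_at \<sigma> x * u x - lam (crit a) * u x) f
      = pairing n (\<lambda>x. lam_at \<sigma> x * u x) f - pairing n (\<lambda>x. lam (crit a) * u x) f"
    using lam_integrable uf_integrable
    by (intro pairing_diff_left) (simp_all add: lam_at_def mult.assoc)
  finally show ?thesis
    using f_in_H1 by (simp add: T_sharp_mult[OF u_in_H1 f_in_H1 c_pos] pairing_scale_left to_dual_def)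
qed

lemma solves_iff_pairing_residual:
  assumes "u \<in> H1"
  shows "solves h n \<sigma> \<eta> c (crit a) u \<longleftrightarrow> (\<forall>f\<in>H1. pairing n (residual a u) f = 0)"
proof -
  have "solves h n \<sigma> \<eta> c (crit a) u \<longleftrightarrow>
     (\<forall>f\<in>H1. T_sharp h n \<sigma> \<eta> c u f - lam (crit a) * to_dual h n \<sigma> \<eta> c u f = to_dual h n \<sigma> \<eta> c \<theta> f)"
    unfolding solves_def fun_eq_iff by (auto simp: to_dual_def restrict_def)
  then show ?thesis
    by (simp add: pairing_residual[OF assms] cong: ball_cong)
qed

lemma extend_line_twisted_cnj_in_H1:
  assumes [measurable]: "g \<in> borel_measurable borel" "\<phi> \<in> borel_measurable borel"
    and sym: "AE t in lborel. g (- t) = of_real \<eta> * g t / \<kappa> t"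
    and even: "AE t in lborel. \<phi> (- t) = \<phi> t"
    and decay: "\<And>t. \<bar>\<phi> t\<bar> * cmod (g t) \<le> K * inverse (1 + t\<^sup>2)"
  shows "extend_line (\<lambda>t. of_real (\<phi> t) * \<kappa> t * cnj (g t)) \<in> H1"
proof (rule H1_if_decay[OF c_pos], unfold extend_line_simps)
  have [measurable]: "cnj \<in> borel_measurable borel"
    by (intro borel_measurable_continuous_onI continuous_intros)
  show "(\<lambda>t. of_real (\<phi> t) * \<kappa> t * cnj (g t)) \<in> borel_measurable borel"
    by measurable
  show "AE t in lborel. of_real (\<phi> (- t)) * \<kappa> (- t) * cnj (g (- t))
      = of_real \<eta> * (of_real (\<phi> t) * \<kappa> t * cnj (g t)) / c_fun h (crit t)"
    using sym even by eventually_elim (simp add: \<kappa>_minus flip: \<kappa>_def)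
  show "cmod (of_real (\<phi> t) * \<kappa> t * cnj (g t)) \<le> K * inverse (1 + t\<^sup>2)" for t
    using decay by (simp add: norm_mult)
qed

definition test_function :: "(real \<Rightarrow> complex) \<Rightarrow> point \<Rightarrow> complex" where
  "test_function g = extend_line (\<lambda>t. of_real (damping g t * Re (\<kappa> t)) * \<kappa> t * cnj (g t))"

lemma test_function_in_H1:
  assumes [measurable]: "g \<in> borel_measurable borel"
    and sym: "AE t in lborel. g (- t) = of_real \<eta> * g t / \<kappa> t"
  shows "test_function g \<in> H1"
  unfolding test_function_def
proof (rule extend_line_twisted_cnj_in_H1[OF _ _ sym])
  show "AE t in lborel. damping g (- t) * Re (\<kappa> (- t)) = damping g t * Re (\<kappa> t)"
    using sym by eventually_elim (simp add: damping_def \<kappa>_minus norm_mult norm_divide)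
  show "\<bar>damping g t * Re (\<kappa> t)\<bar> * cmod (g t) \<le> 1 * inverse (1 + t\<^sup>2)" for t
  proof -
    have "\<bar>Re (\<kappa> t)\<bar> * (damping g t * cmod (g t)) \<le> 1 * inverse (1 + t\<^sup>2)"
      using abs_Re_le_cmod[of "\<kappa> t"] damping_mult_norm_le damping_pos[of g t]
      by (intro mult_mono) (auto simp: less_imp_le)
    then show ?thesis
      using damping_pos[of g t] by (simp add: abs_mult mult_ac)
  qed
qed measurable

lemma Re_mult_test_function:
  "Re (g t * on_line (test_function g) t) = damping g t * (Re (\<kappa> t) * cmod (g t))\<^sup>2"
proof -
  have "g t * on_line (test_function g) t = of_real (damping g t * Re (\<kappa> t) * (cmod (g t))\<^sup>2) * \<kappa> t"
    by (simp only: test_function_def extend_line_simps of_real_mult complex_norm_square mult_ac)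
  then show ?thesis by (simp add: power2_eq_square mult_ac)
qed

lemma AE_zero_if_orthogonal:
  assumes measurable: "g \<in> borel_measurable borel"
    and sym: "AE t in lborel. g (- t) = of_real \<eta> * g t / \<kappa> t"
    and integrable: "\<And>f. f \<in> H1 \<Longrightarrow> integrable lborel (\<lambda>t. g t * on_line f t)"
    and orthogonal: "\<And>f. f \<in> H1 \<Longrightarrow> (\<And>i. f (Inr i) = 0) \<Longrightarrow> (\<integral>t. g t * on_line f t \<partial>lborel) = 0"
  shows "AE t in lborel. g t = 0"
proof -
  let ?f = "test_function g"
  have f_in_H1: "?f \<in> H1"
    by (rule test_function_in_H1[OF measurable sym])
  have "?f (Inr i) = 0" for i
    by (simp add: test_function_def extend_line_simps)
  then have "(\<integral>t. Re (g t * on_line ?f t) \<partial>lborel) = 0"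
    by (simp only: integral_Re[OF integrable[OF f_in_H1]] orthogonal[OF f_in_H1] zero_complex.sel)
  moreover have "AE t in lborel. 0 \<le> Re (g t * on_line ?f t)"
    unfolding Re_mult_test_function
    by (intro AE_I2 mult_nonneg_nonneg less_imp_le[OF damping_pos]) simp
  ultimately have "AE t in lborel. Re (g t * on_line ?f t) = 0"
    using integral_nonneg_eq_0_iff_AE[OF integrable_Re[OF integrable[OF f_in_H1]]] by blast
  then have "AE t in lborel. damping g t * (Re (\<kappa> t) * cmod (g t))\<^sup>2 = 0"
    by (simp only: Re_mult_test_function)
  then show ?thesis
    using AE_Re_\<kappa>_nonzero
    by eventually_elim (use damping_pos[of g] in \<open>auto simp: less_le\<close>)
qed

lemma solves_iff_residual_zero:
  assumes u_in_H1: "u \<in> H1"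
  shows "solves h n \<sigma> \<eta> c (crit a) u \<longleftrightarrow>
    (AE t in lborel. on_line (residual a u) t = 0) \<and> (\<forall>i\<in>{1..n}. residual a u (Inr i) = 0)"
    (is "_ \<longleftrightarrow> ?line \<and> ?points")
proof
  assume "solves h n \<sigma> \<eta> c (crit a) u"
  then have orthogonal: "pairing n (residual a u) f = 0" if "f \<in> H1" for f
    using that solves_iff_pairing_residual[OF u_in_H1] by blast
  have "residual a u (Inr i) = 0" if "i \<in> {1..n}" for i
    using orthogonal[OF indicator_Inr_in_H_space[OF c_pos], of i] that
    by (simp add: pairing_eq if_distrib sum.delta cong: if_cong)
  moreover have ?line
  proof (rule AE_zero_if_orthogonal)
    fix f assume "f \<in> H1" "\<And>i. f (Inr i) = 0"
    then show "(\<integral>t. on_line (residual a u) t * on_line f t \<partial>lborel) = 0"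
      using orthogonal[of f] by (simp add: pairing_eq)
  qed (intro residual_measurable residual_symmetric residual_mult_integrable u_in_H1; assumption)+
  ultimately show "?line \<and> ?points" by blast
next
  assume "?line \<and> ?points"
  then show "solves h n \<sigma> \<eta> c (crit a) u"
    unfolding solves_iff_pairing_residual[OF u_in_H1] by (blast intro: pairing_eq_zero)
qed

lemma solves_iff_eq_sol:
  assumes "u \<in> H1"
  shows "solves h n \<sigma> \<eta> c (crit a) u \<longleftrightarrow> eq_H n u (sol a)"
  using solves_iff_residual_zero[OF assms] residual_zero_iff_eq_sol by blast

lemma theta_zero_if_solves:
  assumes u_in_H1: "u \<in> H1" and "solves h n \<sigma> \<eta> c (crit a) u"
  shows "on_line \<theta> a = 0"
proof (rule isCont_eq_zero_if_square_integrable_quotient[OF isCont_theta])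
  let ?v = "\<lambda>t. - (of_real (t + a) * on_line u t)"
  have "AE t in lborel. on_line (residual a u) t = 0"
    using assms solves_iff_residual_zero by blast
  then show "AE t in lborel. on_line \<theta> t = (t - a) *\<^sub>R ?v t"
    by eventually_elim (simp add: on_line_residual scaleR_conv_of_real power2_eq_square algebra_simps)
  note H1_measurable[OF u_in_H1, measurable]
  show "integrable lborel (\<lambda>t. (cmod (?v t))\<^sup>2)"
  proof (rule Bochner_Integration.integrable_bound)
    show "integrable lborel (\<lambda>t. 2 * (1 + a\<^sup>2 / c) * ((c + 1/4 + t\<^sup>2) * (cmod (on_line u t))\<^sup>2))"
      using u_in_H1[unfolded mem_H1_iff[OF c_pos]] by simp
    have "(t + a)\<^sup>2 \<le> 2 * (1 + a\<^sup>2 / c) * (c + 1/4 + t\<^sup>2)" for t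
    proof -
      have "(t + a)\<^sup>2 \<le> 2 * (t\<^sup>2 + a\<^sup>2)"
        using zero_le_power2[of "t - a"] unfolding power2_sum power2_diff by simp
      also have "a\<^sup>2 \<le> a\<^sup>2 / c * (c + 1/4 + t\<^sup>2)"
        using c_pos by (simp add: field_simps)
      finally show ?thesis
        using c_pos by (simp add: algebra_simps)
    qed
    then have "(cmod (?v t))\<^sup>2 \<le> 2 * (1 + a\<^sup>2 / c) * ((c + 1/4 + t\<^sup>2) * (cmod (on_line u t))\<^sup>2)" for t
      by (simp add: norm_mult power_mult_distrib mult_right_mono del: of_real_add flip: mult.assoc)
    then show "AE t in lborel. norm ((cmod (?v t))\<^sup>2)
        \<le> norm (2 * (1 + a\<^sup>2 / c) * ((c + 1/4 + t\<^sup>2) * (cmod (on_line u t))\<^sup>2))"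
      by (intro AE_I2) (simp only: real_norm_def abs_power2 order_trans[OF _ abs_ge_self])
  qed measurable
qed

lemma theta_factor:
  assumes zero: "on_line \<theta> a = 0" and deriv_zero: "a = 0 \<Longrightarrow> deriv (\<lambda>s. \<theta> (Inl s)) (crit a) = 0"
  obtains g where "g analytic_on range crit" "\<And>s. \<theta> (Inl s) = (lam s - lam (crit a)) * g s"
proof -
  have "(\<lambda>s. \<theta> (Inl s)) analytic_on range crit"
  proof -
    have "c_fun h analytic_on range crit"
      using c_fun_analytic_at_crit analytic_on_analytic_at by blast
    then show ?thesis
      unfolding theta_def by (auto intro!: analytic_intros)
  qed
  then obtain g\<^sub>1 where g\<^sub>1_analytic: "g\<^sub>1 analytic_on range crit"
      and g\<^sub>1_crit: "g\<^sub>1 (crit a) = deriv (\<lambda>s. \<theta> (Inl s)) (crit a)"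
      and theta_eq: "\<And>s. \<theta> (Inl s) = (s - crit a) * g\<^sub>1 s"
    using zero by (rule analytic_on_factor_zero) blast
  have "g\<^sub>1 (crit (- a)) = 0"
  proof (cases "a = 0")
    case True
    then show ?thesis using deriv_zero g\<^sub>1_crit by simp
  next
    case False
    moreover have "on_line \<theta> (- a) = 0"
      by (simp add: theta_minus zero)
    ultimately show ?thesis using theta_eq[of "crit (- a)"] by simp
  qed
  then obtain g where "g analytic_on range crit" "\<And>s. g\<^sub>1 s = (s - crit (- a)) * g s"
    using analytic_on_factor_zero[OF g\<^sub>1_analytic] by blast
  then show ?thesis
    using that theta_eq by (simp add: lam_diff_crit mult.assoc)
qed

lemma sol_decay:
  assumes "on_line \<theta> a = 0" and "a = 0 \<Longrightarrow> deriv (\<lambda>s. \<theta> (Inl s)) (crit a) = 0"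
  obtains K where "\<And>t. cmod (on_line (sol a) t) \<le> K * inverse (1 + t\<^sup>2)"
proof -
  obtain g where g_analytic: "g analytic_on range crit"
    and factor: "\<And>s. \<theta> (Inl s) = (lam s - lam (crit a)) * g s"
    using theta_factor assms by blast
  let ?q = "\<lambda>t. of_real (1 + t\<^sup>2) * g (crit t)"
  have theta_eq: "on_line \<theta> t = of_real (a\<^sup>2 - t\<^sup>2) * g (crit t)" for t
    using factor[of "crit t"] by (simp add: lam_crit)
  have "isCont g (crit t)" for t
    using g_analytic by (intro analytic_at_imp_isCont) (auto intro: analytic_on_subset)
  then have cont: "continuous_on UNIV ?q"
    by (intro continuous_at_imp_continuous_on ballI continuous_intros isCont_o2[OF isCont_crit])
  have "\<forall>\<^sub>F t in at_infinity. cmod (?q t) \<le> 4"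
    using eventually_one_plus_square_le[of a]
  proof eventually_elim
    case (elim t)
    then have "cmod (?q t) \<le> 2 * \<bar>a\<^sup>2 - t\<^sup>2\<bar> * cmod (g (crit t))"
      by (simp add: norm_mult mult_right_mono del: of_real_add)
    also have "\<dots> = 2 * cmod (on_line \<theta> t)"
      by (simp only: theta_eq norm_mult norm_of_real mult.assoc)
    also have "\<dots> \<le> 4"
      using norm_theta_le[of t] by simp
    finally show ?case .
  qed
  then obtain K where bound: "\<And>t. cmod (?q t) \<le> K"
    using bounded_range_if_eventually_bounded[OF cont] by (auto simp: bounded_iff)
  show ?thesis
  proof
    fix t
    \<comment> \<open>not an equality at \<open>t = \<plusminus>a\<close>, where the left side is \<open>0 / 0 = 0\<close>\<close>
    have "cmod (on_line (sol a) t) \<le> cmod (g (crit t))"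
      by (simp add: on_line_sol theta_eq norm_mult norm_divide del: of_real_diff)
    also have "\<dots> \<le> K * inverse (1 + t\<^sup>2)"
      using bound[of t] by (simp add: norm_mult field_simps add_pos_nonneg del: of_real_add)
    finally show "cmod (on_line (sol a) t) \<le> K * inverse (1 + t\<^sup>2)" .
  qed
qed

lemma sol_in_H1:
  assumes "on_line \<theta> a = 0" and "a = 0 \<Longrightarrow> deriv (\<lambda>s. \<theta> (Inl s)) (crit a) = 0"
  shows "sol a \<in> H1"
proof -
  obtain K where "\<And>t. cmod (on_line (sol a) t) \<le> K * inverse (1 + t\<^sup>2)"
    using sol_decay assms by blast
  then show ?thesis
  proof (rule H1_if_decay[OF c_pos, rotated])
    show "on_line (sol a) \<in> borel_measurable borel"
      unfolding on_line_sol by measurable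
    show "AE t in lborel. on_line (sol a) (- t) = of_real \<eta> * on_line (sol a) t / c_fun h (crit t)"
      by (simp add: on_line_sol theta_minus flip: \<kappa>_def)
  qed
qed

end

theorem theorem11:
  fixes h :: "complex \<Rightarrow> complex" and n :: nat and \<sigma> :: "nat \<Rightarrow> real"
    and \<epsilon> \<eta> c :: real and w :: complex
  assumes "h nicely_meromorphic_on UNIV"
    and "zeros_right h = (\<lambda>i. of_real (\<sigma> i)) ` {1..n}"
    and "strict_mono_on {1..n} \<sigma>"
    and "\<forall>x::real. h (of_real x) \<in> \<real>"
    and "\<epsilon> > 0" and "c_growth h \<epsilon>"
    and "\<eta> \<in> {1, -1}"
    and "\<forall>i\<in>{1..n}. of_real \<eta> * Res_c h \<sigma> i \<in> \<real>\<^sub>\<ge>\<^sub>0"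
    and "\<not> L2_crit (\<lambda>s. 1 + of_real \<eta> * c_fun h s)"
    and "c > 0"
    and "Re w = 1/2"
  shows "((\<exists>u\<in>H_space h \<sigma> \<eta> c 1. solves h n \<sigma> \<eta> c w u) \<longrightarrow> theta h \<sigma> \<eta> (Inl w) = 0) \<and>
         (theta h \<sigma> \<eta> (Inl w) = 0 \<and> (w = 1/2 \<longrightarrow> deriv (\<lambda>s. theta h \<sigma> \<eta> (Inl s)) w = 0) \<longrightarrow>
            u_sol h \<sigma> \<eta> w \<in> H_space h \<sigma> \<eta> c 1 \<and>
            solves h n \<sigma> \<eta> c w (u_sol h \<sigma> \<eta> w) \<and>
            (\<forall>u\<in>H_space h \<sigma> \<eta> c 1. solves h n \<sigma> \<eta> c w u \<longrightarrow> eq_H n u (u_sol h \<sigma> \<eta> w)))"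
proof -
  have "\<sigma> i > 1/2" if "i \<in> {1..n}" for i
  proof -
    have "of_real (\<sigma> i) \<in> zeros_right h"
      using assms(2) that by blast
    then show ?thesis by (simp add: zeros_right_def)
  qed
  moreover have "\<exists>s. h s \<noteq> 0"
    using assms(2) by (intro nonzero_if_finite_zeros_right) simp
  ultimately interpret critical_line h n \<sigma> \<eta> c
    using assms by unfold_locales auto
  obtain a where w: "w = crit a"
    using \<open>Re w = 1/2\<close> by (metis crit_def complex.collapse)
  have half: "crit a = 1/2" if "a = 0"
    using that by (simp add: crit_def complex_eq_iff)
  have "sol a \<in> H1"
    if "on_line \<theta> a = 0" "crit a = 1/2 \<longrightarrow> deriv (\<lambda>s. \<theta> (Inl s)) (crit a) = 0"
    using sol_in_H1 half that by blast
  moreover have "eq_H n (sol a) (sol a)"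
    by (simp add: eq_H_def)
  ultimately show ?thesis
    unfolding w using theta_zero_if_solves solves_iff_eq_sol by blast
qed

end
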